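(* Let $\mathfrak{A}$ be a $C^*$-algebra and $H$ a Hilbert $\mathfrak{A}$-module. Let $T\in\mathcal{L}(H)$ have the polar decomposition $T=U|T|$. Then the following statements are equivalent: (i) $T$ is a centered operator; (ii) $[|T^n|,|(T^m)^*|]=0$ for any $m,n\in\mathbb{N}$; (iii) $[|T^n|,|T^*|]=0$ for any $n\in\mathbb{N}$; (iv) $T$ is commutative along any restricted sequence; (v) $T$ is commutative along some restricted sequence; (vi) $[U^m|T|(U^m)^*,|T^n|]=0$ for any $m,n\in\mathbb{N}$; (vii) $[U^n|T|(U^n)^*,|T|]=0$ for any $n\in\mathbb{N}$; (viii) $[|(T^n)^*|,|T|]=0$ for any $n\in\mathbb{N}$; (ix) $[(U^n)^*|T^*|U^n,|T^*|]=0$ for any $n\in\mathbb{N}$; (x) $[(U^m)^*|T^*|U^m,|(T^n)^*|]=0$ for any $m,n\in\mathbb{N}$; (xi) the operators in $\{|T|,\,U|T|U^*,\,U^*|T|U,\,U^2|T|(U^2)^*,\,(U^2)^*|T|U^2,\,\ldots\}$ commute with one another.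
   Context: $\mathbb{N}=\{1,2,3,\ldots\}$. $\mathcal{L}(H)$ is the $C^*$-algebra of adjointable operators on $H$ (maps $T:H\to H$ having an adjoint $T^*$ with $\langle Tx,y\rangle=\langle x,T^*y\rangle$ for all $x,y\in H$). For $S\in\mathcal{L}(H)$, $|S|=(S^*S)^{1/2}$, so $|S^*|=(SS^* )^{1/2}$; $\mathcal{R}(S)$ is the range of $S$ and the bar denotes norm closure. $[A,B]=AB-BA$. A closed submodule $M$ of $H$ is orthogonally complemented if $H=M\dotplus M^\perp$, where $M^\perp=\{x\in H:\langle x,y\rangle=0\text{ for all }y\in M\}$; then $P_M$ is the projection of $H$ onto $M$ along $M^\perp$. $U\in\mathcal{L}(H)$ is a partial isometry if $U^*U$ is a projection. "$T$ has the polar decomposition $T=U|T|$" means: $U\in\mathcal{L}(H)$ is a partial isometry, $T=U|T|$, $\overline{\mathcal{R}(T^* )}$ is orthogonally complemented, and $U^*U=P_{\overline{\mathcal{R}(T^* )}}$ (such a $U$ is unique when it exists). $T\in\mathcal{L}(H)$ is centered if the operators in the sequence $\ldots,T^3(T^3)^*,T^2(T^2)^*,TT^*,T^*T,(T^2)^*T^2,(T^3)^*T^3,\ldots$ mutually commute. A sequence $\{t_n\}_{n=1}^\infty$ is called restricted if $t_n\in\{1,2,\ldots,n\}$ for each $n\in\mathbb{N}$. An operator $T\in\mathcal{L}(H)$ is called commutative along this restricted sequence if $T$ has the polar decomposition $T=U|T|$ and $[U^{t_n}|T|(U^{t_n})^*,|T^{n+1-t_n}|]=0$ for every $n\in\mathbb{N}$.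 *)

theory Defs
  imports "HOL-Analysis.Analysis"
begin

section \<open>\<open>C\<^sup>*\<close>-algebras\<close>

class complex_banach = banach +
  fixes scaleC :: "complex \<Rightarrow> 'a \<Rightarrow> 'a"  (infixr \<open>*\<^sub>C\<close> 75)
  assumes scaleC_add_right: "c *\<^sub>C (x + y) = c *\<^sub>C x + c *\<^sub>C y"
    and scaleC_add_left: "(c + d) *\<^sub>C x = c *\<^sub>C x + d *\<^sub>C x"
    and scaleC_scaleC: "c *\<^sub>C (d *\<^sub>C x) = (c * d) *\<^sub>C x"
    and scaleC_of_real: "complex_of_real r *\<^sub>C x = scaleR r x"
    and norm_scaleC: "norm (c *\<^sub>C x) = cmod c * norm x"

text \<open>No unit is assumed.\<close>

class cstar_algebra = complex_banach + real_normed_algebra +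
  fixes star :: "'a \<Rightarrow> 'a"
  assumes mult_scaleC_left: "(c *\<^sub>C x) * y = c *\<^sub>C (x * y)"
    and mult_scaleC_right: "x * (c *\<^sub>C y) = c *\<^sub>C (x * y)"
    and star_add: "star (x + y) = star x + star y"
    and star_scaleC: "star (c *\<^sub>C x) = cnj c *\<^sub>C star x"
    and star_mult: "star (x * y) = star y * star x"
    and star_star: "star (star x) = x"
    and cstar_identity: "norm (star x * x) = (norm x)\<^sup>2"

text \<open>
  Multiplication of the unitization \<open>\<complex> \<oplus> A\<close>, with unit \<open>(1, 0)\<close>. The spectrum is taken
  in the unitization even if \<open>A\<close> has a unit; this can only add the point \<open>0\<close> and so does
  not affect positivity.
\<close>

definition unitization_mult ::
    "complex \<times> 'a::cstar_algebra \<Rightarrow> complex \<times> 'a \<Rightarrow> complex \<times> 'a" where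
  "unitization_mult v w =
     (fst v * fst w, fst v *\<^sub>C snd w + fst w *\<^sub>C snd v + snd v * snd w)"

definition cstar_spectrum :: "'a::cstar_algebra \<Rightarrow> complex set" where
  "cstar_spectrum a =
     {c. \<not> (\<exists>w. unitization_mult (c, - a) w = (1, 0) \<and> unitization_mult w (c, - a) = (1, 0))}"

definition cstar_positive :: "'a::cstar_algebra \<Rightarrow> bool" where
  "cstar_positive a \<longleftrightarrow> star a = a \<and> cstar_spectrum a \<subseteq> \<real>\<^sub>\<ge>\<^sub>0"


section \<open>Hilbert modules\<close>

text \<open>
  Right modules, with inner product linear in the second variable. The norm of \<open>H\<close> is the one
  induced by the inner product; completeness comes from the type class.
\<close>

locale hilbert_cstar_module =
  fixes act :: "'h::complex_banach \<Rightarrow> 'a::cstar_algebra \<Rightarrow> 'h"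
    and ip :: "'h \<Rightarrow> 'h \<Rightarrow> 'a"
  assumes act_add_left: "act (x + y) a = act x a + act y a"
    and act_add_right: "act x (a + b) = act x a + act x b"
    and act_mult: "act x (a * b) = act (act x a) b"
    and act_scaleC_left: "act (c *\<^sub>C x) a = c *\<^sub>C act x a"
    and act_scaleC_right: "act x (c *\<^sub>C a) = c *\<^sub>C act x a"
    and ip_add_right: "ip x (y + z) = ip x y + ip x z"
    and ip_scaleC_right: "ip x (c *\<^sub>C y) = c *\<^sub>C ip x y"
    and ip_act_right: "ip x (act y a) = ip x y * a"
    and ip_star: "ip y x = star (ip x y)"
    and ip_positive: "cstar_positive (ip x x)"
    and ip_eq_zero_iff: "ip x x = 0 \<longleftrightarrow> x = 0"
    and norm_eq_sqrt_ip: "norm x = sqrt (norm (ip x x))"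


section \<open>Adjointable operators\<close>

definition adjointable :: "('h \<Rightarrow> 'h \<Rightarrow> 'a) \<Rightarrow> ('h \<Rightarrow> 'h) set" where
  "adjointable ip = {T. \<exists>T'. \<forall>x y. ip (T x) y = ip x (T' y)}"

definition adj :: "('h \<Rightarrow> 'h \<Rightarrow> 'a) \<Rightarrow> ('h \<Rightarrow> 'h) \<Rightarrow> ('h \<Rightarrow> 'h)" where
  "adj ip T = (THE T'. \<forall>x y. ip (T x) y = ip x (T' y))"

definition op_spectrum ::
    "('h::complex_banach \<Rightarrow> 'h \<Rightarrow> 'a) \<Rightarrow> ('h \<Rightarrow> 'h) \<Rightarrow> complex set" where
  "op_spectrum ip T =
     {c. \<not> (\<exists>R \<in> adjointable ip.
              (\<lambda>x. c *\<^sub>C x - T x) \<circ> R = id \<and> R \<circ> (\<lambda>x. c *\<^sub>C x - T x) = id)}"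

definition op_positive ::
    "('h::complex_banach \<Rightarrow> 'h \<Rightarrow> 'a) \<Rightarrow> ('h \<Rightarrow> 'h) \<Rightarrow> bool" where
  "op_positive ip T \<longleftrightarrow> T \<in> adjointable ip \<and> adj ip T = T \<and> op_spectrum ip T \<subseteq> \<real>\<^sub>\<ge>\<^sub>0"

definition op_sqrt ::
    "('h::complex_banach \<Rightarrow> 'h \<Rightarrow> 'a) \<Rightarrow> ('h \<Rightarrow> 'h) \<Rightarrow> ('h \<Rightarrow> 'h)" where
  "op_sqrt ip T = (THE R. op_positive ip R \<and> R \<circ> R = T)"

definition op_abs ::
    "('h::complex_banach \<Rightarrow> 'h \<Rightarrow> 'a) \<Rightarrow> ('h \<Rightarrow> 'h) \<Rightarrow> ('h \<Rightarrow> 'h)" where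
  "op_abs ip S = op_sqrt ip (adj ip S \<circ> S)"

definition commutator :: "('h::ab_group_add \<Rightarrow> 'h) \<Rightarrow> ('h \<Rightarrow> 'h) \<Rightarrow> ('h \<Rightarrow> 'h)" where
  "commutator A B = (\<lambda>x. A (B x) - B (A x))"

definition commuting_family :: "('h::ab_group_add \<Rightarrow> 'h) set \<Rightarrow> bool" where
  "commuting_family F \<longleftrightarrow> (\<forall>A\<in>F. \<forall>B\<in>F. commutator A B = (\<lambda>_. 0))"


section \<open>Polar decomposition\<close>

definition orth_compl :: "('h \<Rightarrow> 'h \<Rightarrow> 'a::zero) \<Rightarrow> 'h set \<Rightarrow> 'h set" where
  "orth_compl ip M = {x. \<forall>y\<in>M. ip x y = 0}"

definition orth_complemented ::
    "('h::ab_group_add \<Rightarrow> 'h \<Rightarrow> 'a::zero) \<Rightarrow> 'h set \<Rightarrow> bool" where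
  "orth_complemented ip M \<longleftrightarrow>
     {x + y | x y. x \<in> M \<and> y \<in> orth_compl ip M} = UNIV \<and> M \<inter> orth_compl ip M = {0}"

definition orth_proj ::
    "('h::ab_group_add \<Rightarrow> 'h \<Rightarrow> 'a::zero) \<Rightarrow> 'h set \<Rightarrow> 'h \<Rightarrow> 'h" where
  "orth_proj ip M x = (THE y. y \<in> M \<and> x - y \<in> orth_compl ip M)"

definition projection_op :: "('h \<Rightarrow> 'h \<Rightarrow> 'a) \<Rightarrow> ('h \<Rightarrow> 'h) \<Rightarrow> bool" where
  "projection_op ip P \<longleftrightarrow> P \<in> adjointable ip \<and> adj ip P = P \<and> P \<circ> P = P"

definition partial_isometry :: "('h \<Rightarrow> 'h \<Rightarrow> 'a) \<Rightarrow> ('h \<Rightarrow> 'h) \<Rightarrow> bool" where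
  "partial_isometry ip U \<longleftrightarrow> U \<in> adjointable ip \<and> projection_op ip (adj ip U \<circ> U)"

definition polar_decomposition ::
    "('h::complex_banach \<Rightarrow> 'h \<Rightarrow> 'a::zero) \<Rightarrow> ('h \<Rightarrow> 'h) \<Rightarrow> ('h \<Rightarrow> 'h) \<Rightarrow> bool" where
  "polar_decomposition ip T U \<longleftrightarrow>
     partial_isometry ip U \<and>
     T = U \<circ> op_abs ip T \<and>
     orth_complemented ip (closure (range (adj ip T))) \<and>
     adj ip U \<circ> U = orth_proj ip (closure (range (adj ip T)))"


section \<open>Centered operators and restricted sequences\<close>

definition centered :: "('h::ab_group_add \<Rightarrow> 'h \<Rightarrow> 'a) \<Rightarrow> ('h \<Rightarrow> 'h) \<Rightarrow> bool" where
  "centered ip T \<longleftrightarrow>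
     commuting_family
       ({T ^^ n \<circ> adj ip (T ^^ n) | n. n \<ge> 1} \<union> {adj ip (T ^^ n) \<circ> T ^^ n | n. n \<ge> 1})"

text \<open>Sequences are indexed from \<open>1\<close>; the value at \<open>0\<close> is irrelevant.\<close>

definition restricted_seq :: "(nat \<Rightarrow> nat) \<Rightarrow> bool" where
  "restricted_seq t \<longleftrightarrow> (\<forall>n\<ge>1. t n \<in> {1..n})"

definition commutative_along ::
    "('h::complex_banach \<Rightarrow> 'h \<Rightarrow> 'a::zero) \<Rightarrow> ('h \<Rightarrow> 'h) \<Rightarrow> (nat \<Rightarrow> nat) \<Rightarrow> bool" where
  "commutative_along ip T t \<longleftrightarrow>
     (\<exists>U. polar_decomposition ip T U \<and>
        (\<forall>n\<ge>1. commutator (U ^^ t n \<circ> op_abs ip T \<circ> adj ip (U ^^ t n))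
                           (op_abs ip (T ^^ (n + 1 - t n))) = (\<lambda>_. 0)))"

end

theory Submission
  imports Defs
begin

text \<open>
  Write \<open>a = |T|\<close>, \<open>b = |T\<^sup>*| = U a U\<^sup>*\<close>, \<open>A n = |T\<^sup>n|\<close>. If \<open>A k\<close> commutes with \<open>b\<close>, then
  \<open>A (k+1) = a U\<^sup>* (A k) U\<close>. Since \<open>ker a = ker U\<close>, it follows that a self-adjoint \<open>X\<close> commuting
  with \<open>a\<close> commutes with \<open>A (k+1)\<close> iff \<open>U X U\<^sup>*\<close> commutes with \<open>A k\<close>. Applied to \<open>X = U\<^sup>m a (U\<^sup>m)\<^sup>*\<close>,
  this makes all relations \<open>[U\<^sup>m a (U\<^sup>m)\<^sup>*, A k] = 0\<close> on a diagonal \<open>m + k = n + 1\<close> equivalent once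
  those on smaller diagonals hold, so one relation per diagonal gives all of them. Conjugation by
  \<open>U\<close> yields the remaining commutation relations, and exchanging \<open>(U, a)\<close> with \<open>(U\<^sup>*, b)\<close>
  the statements about \<open>T\<^sup>*\<close>.

  Square roots of positive operators come from the iteration \<open>Y \<mapsto> (X + Y\<^sup>2) / 2\<close>. For a self-adjoint
  \<open>R\<close> with \<open>\<parallel>R\<parallel> \<le> M\<close>, a nonnegative spectrum means \<open>\<parallel>M - R\<parallel> \<le> M\<close>, which rests on the equality of norm
  and spectral radius, proved without holomorphic functions following Rickart.
\<close>

section \<open>Adjointable operators\<close>

text \<open>Positivity is defined by the spectrum, both in the algebra and for operators. Positivity
  of \<open>S' (S x)\<close> and the Cauchy-Schwarz inequality of a Hilbert module both require
  comparing norms of positive elements of the algebra. The circle is broken by running the operator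
  theory twice: for the algebra with \<open>star a * b\<close> as inner product, Cauchy-Schwarz is
  submultiplicativity of the norm, and the norm monotonicity obtained there yields Cauchy-Schwarz
  for the module. In place of a functional calculus, positivity is used in two forms: invertibility
  of \<open>s + R\<close> for \<open>s > 0\<close> is what the spectrum provides, while the norm
  form is stable under sums and starts the square root iteration. On the polar side, closed ranges
  are traded for equations between \<open>U\<close>, \<open>V\<close>, \<open>a\<close> and a kernel
  inclusion. These are inherited by the adjoint data, so the polar decomposition of the adjoint
  operator needs no separate construction.\<close>

lemma scaleC_one [simp]: "1 *\<^sub>C x = (x :: 'a::complex_banach)"
  using scaleC_of_real[of 1 x] by simp

lemma scaleC_zero_left [simp]: "0 *\<^sub>C x = (0 :: 'a::complex_banach)"
  using scaleC_of_real[of 0 x] by simp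

lemma scaleC_zero_right [simp]: "c *\<^sub>C (0 :: 'a::complex_banach) = 0"
  by (metis norm_eq_zero norm_scaleC mult_zero_right norm_zero)

lemma scaleC_minus_left: "(- c) *\<^sub>C x = - (c *\<^sub>C (x :: 'a::complex_banach))"
  by (metis add.left_inverse add_eq_0_iff2 scaleC_add_left scaleC_zero_left)

lemma scaleC_minus_right: "c *\<^sub>C (- x) = - (c *\<^sub>C (x :: 'a::complex_banach))"
  by (metis add.left_inverse add_eq_0_iff2 scaleC_add_right scaleC_zero_right)

lemma scaleC_diff_right: "c *\<^sub>C (x - y) = c *\<^sub>C x - c *\<^sub>C (y :: 'a::complex_banach)"
  by (metis diff_conv_add_uminus scaleC_add_right scaleC_minus_right)

lemma scaleC_diff_left: "(c - d) *\<^sub>C x = c *\<^sub>C x - d *\<^sub>C (x :: 'a::complex_banach)"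
  by (metis diff_conv_add_uminus scaleC_add_left scaleC_minus_left)

lemma scaleC_scaleR: "c *\<^sub>C (r *\<^sub>R x) = (c * of_real r) *\<^sub>C (x :: 'a::complex_banach)"
  by (metis scaleC_of_real scaleC_scaleC)

lemma scaleR_scaleC: "r *\<^sub>R (c *\<^sub>C x) = (of_real r * c) *\<^sub>C (x :: 'a::complex_banach)"
  by (metis scaleC_of_real scaleC_scaleC)

lemmas scaleC_linear = scaleC_add_right scaleC_add_left scaleC_diff_right scaleC_diff_left
  scaleC_minus_right scaleC_minus_left

lemma star_scaleR: "star (r *\<^sub>R x) = r *\<^sub>R star (x :: 'a::cstar_algebra)"
  by (metis complex_cnj_complex_of_real scaleC_of_real star_scaleC)

lemma norm_star [simp]: "norm (star x) = norm (x :: 'a::cstar_algebra)"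
proof -
  have le: "norm y \<le> norm (star y)" for y :: 'a
  proof (cases "norm y = 0")
    case False
    have "norm y * norm y \<le> norm (star y) * norm y"
      using cstar_identity[of y] norm_mult_ineq[of "star y" y] by (simp add: power2_eq_square)
    then show ?thesis using False by simp
  qed simp
  show ?thesis using le[of x] le[of "star x"] by (simp add: star_star)
qed

text \<open>
  Positivity of the inner product is not assumed, so that the operator theory applies both to
  Hilbert modules and to a \<open>C\<^sup>*\<close>-algebra acting on itself by left multiplication, where positivity
  of \<open>star a * a\<close> would be a theorem in its own right.
\<close>

locale cs_module =
  fixes ip :: "'h::complex_banach \<Rightarrow> 'h \<Rightarrow> 'a::cstar_algebra"
  assumes ip_add_right: "ip x (y + z) = ip x y + ip x z"
    and ip_scaleC_right: "ip x (c *\<^sub>C y) = c *\<^sub>C ip x y"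
    and ip_star: "ip y x = star (ip x y)"
    and norm_ip_self: "norm (ip x x) = (norm x)\<^sup>2"
    and Cauchy_Schwarz: "norm (ip x y) \<le> norm x * norm y"
begin

lemma ip_add_left: "ip (x + y) z = ip x z + ip y z"
  by (metis ip_add_right ip_star star_add)

lemma ip_scaleC_left: "ip (c *\<^sub>C x) y = cnj c *\<^sub>C ip x y"
  by (metis ip_scaleC_right ip_star star_scaleC)

sublocale ip: bounded_bilinear ip
proof (rule bounded_bilinear.intro)
  show "\<exists>K. \<forall>a b. norm (ip a b) \<le> norm a * norm b * K"
    using Cauchy_Schwarz by (intro exI[of _ 1]) simp
next
  fix r :: real and a b
  show "ip (r *\<^sub>R a) b = r *\<^sub>R ip a b"
    by (metis complex_cnj_complex_of_real ip_scaleC_left scaleC_of_real)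
  show "ip a (r *\<^sub>R b) = r *\<^sub>R ip a b"
    by (metis ip_scaleC_right scaleC_of_real)
qed (simp_all add: ip_add_left ip_add_right)

lemma ip_ext_right: "(\<And>x. ip x y = ip x z) \<Longrightarrow> y = z"
proof -
  assume "\<And>x. ip x y = ip x z"
  then have "ip (y - z) (y - z) = 0" by (simp add: ip.diff_right)
  then show "y = z" using norm_ip_self[of "y - z"] by simp
qed

text \<open>The adjoint is carried as an explicit witness, so that algebra and estimates avoid the
  description operator in \<open>adj\<close>; \<open>adjpair_adj\<close> leads back to it.\<close>

definition adjpair :: "('h \<Rightarrow> 'h) \<Rightarrow> ('h \<Rightarrow> 'h) \<Rightarrow> bool" where
  "adjpair S S' \<longleftrightarrow> (\<forall>x y. ip (S x) y = ip x (S' y))"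

lemma adjpairI: "(\<And>x y. ip (S x) y = ip x (S' y)) \<Longrightarrow> adjpair S S'"
  by (simp add: adjpair_def)

lemma adjpairD: "adjpair S S' \<Longrightarrow> ip (S x) y = ip x (S' y)"
  by (simp add: adjpair_def)

lemma adjpair_sym: "adjpair S S' \<Longrightarrow> adjpair S' S"
  unfolding adjpair_def by (metis ip_star)

lemma adjpairD': "adjpair S S' \<Longrightarrow> ip x (S y) = ip (S' x) y"
  using adjpairD[OF adjpair_sym] by simp

lemma adjpair_additive: "adjpair S S' \<Longrightarrow> S (x + y) = S x + S y"
  by (rule ip_ext_right) (simp add: adjpairD' ip_add_right)

lemma adjpair_homogeneous: "adjpair S S' \<Longrightarrow> S (c *\<^sub>C x) = c *\<^sub>C S x"
  by (rule ip_ext_right) (simp add: adjpairD' ip_scaleC_right)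

lemma adjpair_unique: "adjpair S S' \<Longrightarrow> adjpair S S'' \<Longrightarrow> S' = S''"
  unfolding adjpair_def by (metis ext ip_ext_right)

lemma adjpair_adj: "adjpair S S' \<Longrightarrow> adj ip S = S'"
  unfolding adj_def
  by (rule the_equality) (auto simp flip: adjpair_def intro: adjpair_unique)

lemma adjpair_adjointable: "adjpair S S' \<Longrightarrow> S \<in> adjointable ip"
  by (auto simp: adjointable_def adjpair_def)

lemma adjointable_adjpair: "S \<in> adjointable ip \<Longrightarrow> adjpair S (adj ip S)"
  unfolding adjointable_def using adjpair_adj by (auto simp: adjpair_def)

lemma adjpair_id: "adjpair (\<lambda>x. x) (\<lambda>x. x)"
  by (simp add: adjpair_def)

lemma adjpair_comp: "adjpair A A' \<Longrightarrow> adjpair B B' \<Longrightarrow> adjpair (\<lambda>x. A (B x)) (\<lambda>x. B' (A' x))"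
  by (simp add: adjpair_def)

lemma adjpair_funpow: "adjpair A A' \<Longrightarrow> adjpair (A ^^ n) (A' ^^ n)"
proof (induction n)
  case (Suc n)
  then show ?case
    using adjpair_comp[of A A' "A ^^ n" "A' ^^ n"] by (simp add: funpow_swap1 adjpair_def)
qed (simp add: adjpair_def)

lemma adjpair_add: "adjpair A A' \<Longrightarrow> adjpair B B' \<Longrightarrow> adjpair (\<lambda>x. A x + B x) (\<lambda>x. A' x + B' x)"
  by (simp add: adjpair_def ip_add_left ip_add_right)

lemma adjpair_diff: "adjpair A A' \<Longrightarrow> adjpair B B' \<Longrightarrow> adjpair (\<lambda>x. A x - B x) (\<lambda>x. A' x - B' x)"
  by (simp add: adjpair_def ip.diff_left ip.diff_right)

lemma adjpair_minus: "adjpair A A' \<Longrightarrow> adjpair (\<lambda>x. - A x) (\<lambda>x. - A' x)"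
  by (simp add: adjpair_def ip.minus_left ip.minus_right)

lemma adjpair_scaleC: "adjpair A A' \<Longrightarrow> adjpair (\<lambda>x. c *\<^sub>C A x) (\<lambda>x. cnj c *\<^sub>C A' x)"
  by (simp add: adjpair_def ip_scaleC_left ip_scaleC_right)

lemma adjpair_scaleR: "adjpair A A' \<Longrightarrow> adjpair (\<lambda>x. r *\<^sub>R A x) (\<lambda>x. r *\<^sub>R A' x)"
  by (simp add: adjpair_def ip.scaleR_left ip.scaleR_right)

lemmas adjpair_intros = adjpair_id adjpair_add adjpair_diff adjpair_minus
  adjpair_scaleC adjpair_scaleR

text \<open>Uniform boundedness, applied to the functionals \<open>\<lambda>x. ip (S y) x\<close> with \<open>norm y \<le> 1\<close>.\<close>

lemma adjpair_bound:
  assumes S: "adjpair S S'"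
  obtains K where "K \<ge> 0" "\<And>x. norm (S x) \<le> K * norm x"
proof -
  have add: "S (x + y) = S x + S y" for x y
    using S by (rule adjpair_additive)
  have scale: "S (r *\<^sub>R x) = r *\<^sub>R S x" for r x
    using adjpair_homogeneous[OF S] by (simp flip: scaleC_of_real)
  define F where "F n = {x. \<forall>y. norm y \<le> 1 \<longrightarrow> norm (ip (S y) x) \<le> real n}" for n :: nat
  have cl: "closed (F n)" for n
  proof -
    have "F n = (\<Inter>y\<in>{y. norm y \<le> 1}. {x. norm (ip (S y) x) \<le> real n})"
      by (auto simp: F_def)
    moreover have "closed {x. norm (ip (S y) x) \<le> real n}" for y
      by (intro closed_Collect_le continuous_intros linear_continuous_on ip.bounded_linear_right)
    ultimately show ?thesis by auto
  qed
  have "\<exists>n. x \<in> F n" for x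
  proof -
    obtain n :: nat where n: "norm (S' x) \<le> real n" using real_arch_simple by blast
    have "norm (ip (S y) x) \<le> real n" if "norm y \<le> 1" for y
    proof -
      have "norm (ip (S y) x) \<le> norm y * norm (S' x)"
        using Cauchy_Schwarz[of y "S' x"] S by (simp add: adjpairD)
      also have "\<dots> \<le> norm (S' x)" using that by (simp add: mult_left_le_one_le)
      finally show ?thesis using n by linarith
    qed
    then show ?thesis by (auto simp: F_def)
  qed
  then have un: "\<Union> (range F) = UNIV" by auto
  have "\<exists>n. interior (F n) \<noteq> {}"
  proof (rule ccontr)
    assume *: "\<not> ?thesis"
    have "Met_TC.mtopology interior_of \<Union> (range F) = {}"
      by (rule Met_TC.metric_Baire_category_alt)
         (use cl * in \<open>auto simp: complete_UNIV\<close>)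
    then show False using un by simp
  qed
  then obtain n x0 e where e: "e > 0" "ball x0 e \<subseteq> F n"
    by (metis ex_in_conv mem_interior)
  have small: "norm (ip (S y) x) \<le> 2 * real n" if "norm y \<le> 1" "norm x < e" for x y
  proof -
    have "x0 + x \<in> F n" "x0 \<in> F n" using e that by (auto simp: dist_norm)
    then have "norm (ip (S y) (x0 + x)) \<le> real n" "norm (ip (S y) x0) \<le> real n"
      using that by (auto simp: F_def)
    moreover have "ip (S y) x = ip (S y) (x0 + x) - ip (S y) x0" by (simp add: ip_add_right)
    ultimately show ?thesis
      using norm_triangle_ineq4[of "ip (S y) (x0 + x)" "ip (S y) x0"] by simp
  qed
  define K where "K = 4 * real n / e"
  have unit: "norm (S y) \<le> K" if "norm y \<le> 1" for y
  proof (cases "S y = 0")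
    case False
    define r where "r = e / (2 * norm (S y))"
    have "norm (r *\<^sub>R S y) < e" using False e by (simp add: r_def)
    from small[OF that this] have "r * (norm (S y))\<^sup>2 \<le> 2 * real n"
      using False e by (simp add: ip.scaleR_right norm_ip_self r_def)
    then show ?thesis
      using False e by (simp add: r_def K_def power2_eq_square field_simps)
  qed (use e in \<open>simp add: K_def\<close>)
  have "norm (S x) \<le> K * norm x" for x
  proof (cases "x = 0")
    case True then show ?thesis using scale[of 0 0] by simp
  next
    case False
    have "norm (S ((1 / norm x) *\<^sub>R x)) \<le> K" using False by (intro unit) simp
    then show ?thesis using False by (simp add: scale field_simps)
  qed
  moreover have "K \<ge> 0" using e by (simp add: K_def)
  ultimately show ?thesis using that by blast
qed

lemma adjpair_bounded_linear:
  assumes "adjpair S S'" shows "bounded_linear S"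
proof -
  obtain K where "\<And>x. norm (S x) \<le> K * norm x" using adjpair_bound[OF assms] by blast
  then show ?thesis
    using assms by (intro bounded_linear_intro[of _ K])
      (auto simp: adjpair_additive mult.commute adjpair_homogeneous[OF assms] simp flip: scaleC_of_real)
qed

text \<open>Cauchy-Schwarz for \<open>ip (S x) (S x) = ip x (S' (S x))\<close>; a source of the
  C*-type estimates below.\<close>

lemma adjpair_norm_square:
  assumes "adjpair S S'" shows "(norm (S x))\<^sup>2 \<le> norm x * norm (S' (S x))"
  using Cauchy_Schwarz[of x "S' (S x)"] assms by (metis adjpairD norm_ip_self)

lemma adjpair_bound_transfer:
  assumes S: "adjpair S S'" and K: "\<And>x. norm (S x) \<le> K * norm x"
  shows "norm (S' x) \<le> K * norm x"
proof (cases "S' x = 0")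
  case True
  then show ?thesis using K[of x] norm_ge_zero[of "S x"] by (simp del: norm_ge_zero)
next
  case False
  have "norm (S' x) * norm (S' x) \<le> norm x * (K * norm (S' x))"
    using adjpair_norm_square[OF adjpair_sym[OF S], of x] K[of "S' x"]
    by (smt (verit, ccfv_SIG) mult_left_mono norm_ge_zero power2_eq_square)
  then show ?thesis using False by (simp add: algebra_simps)
qed

definition sa :: "('h \<Rightarrow> 'h) \<Rightarrow> bool" where
  "sa S \<longleftrightarrow> adjpair S S"

lemma sa_bound_of_square:
  assumes S: "sa S" and K: "K \<ge> 0" "\<And>x. norm (S (S x)) \<le> K\<^sup>2 * norm x"
  shows "norm (S x) \<le> K * norm x"
proof (rule power2_le_imp_le)
  have "(norm (S x))\<^sup>2 \<le> norm x * (K\<^sup>2 * norm x)"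
    using adjpair_norm_square[of S S x] S K(2)[of x] unfolding sa_def
    by (smt (verit, ccfv_SIG) mult_left_mono norm_ge_zero)
  then show "(norm (S x))\<^sup>2 \<le> (K * norm x)\<^sup>2" by (simp add: power2_eq_square algebra_simps)
qed (use K in simp)

lemma sa_funpow: "sa S \<Longrightarrow> sa (S ^^ n)"
  unfolding sa_def by (rule adjpair_funpow)

text \<open>Powers of a self-adjoint operator are self-adjoint, so \<open>sa_bound_of_square\<close>
  halves the exponent at each step.\<close>

lemma sa_bound_of_power:
  assumes S: "sa S" and K: "K \<ge> 0" "\<And>x. norm ((S ^^ (2 ^ k)) x) \<le> K ^ (2 ^ k) * norm x"
  shows "norm (S x) \<le> K * norm x"
  using K(2)
proof (induction k arbitrary: x)
  case (Suc k)
  have "norm ((S ^^ (2 ^ k)) x) \<le> K ^ (2 ^ k) * norm x" for x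
  proof (rule sa_bound_of_square[OF sa_funpow[OF S]])
    show "norm ((S ^^ 2 ^ k) ((S ^^ 2 ^ k) x)) \<le> (K ^ 2 ^ k)\<^sup>2 * norm x" for x
      using Suc.prems[of x] by (simp add: mult_2 funpow_add power_add power2_eq_square)
  qed (use K in simp)
  then show ?case by (rule Suc.IH)
qed simp

end

section \<open>Invertibility and spectral radius\<close>

lemma bij_id_minus_contraction:
  fixes E :: "'h::banach \<Rightarrow> 'h"
  assumes E: "linear E" and q: "q < 1" "\<And>x. norm (E x) \<le> q * norm x"
  shows "bij (\<lambda>x. x - E x)"
proof (rule bijI')
  \<comment> \<open>Solving \<open>x - E x = y\<close> is a fixed point problem. The theorem asks
    for a constant in [0, 1), hence \<open>max q 0\<close>.\<close>
  have *: "\<exists>!x. y + E x = x" for y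
  proof (rule banach_fix_type[of "max q 0"])
    show "\<forall>x x'. dist (y + E x) (y + E x') \<le> max q 0 * dist x x'"
    proof (intro allI)
      fix x x'
      have "dist (y + E x) (y + E x') = norm (E (x - x'))"
        by (simp add: dist_norm linear_diff[OF E])
      also have "\<dots> \<le> max q 0 * norm (x - x')"
        using q(2)[of "x - x'"] by (smt (verit) mult_right_mono norm_ge_zero)
      finally show "dist (y + E x) (y + E x') \<le> max q 0 * dist x x'" by (simp add: dist_norm)
    qed
  qed (use q in auto)
  show "(x - E x = y - E y) = (x = y)" for x y
    using *[of "x - E x"] by (metis add.commute diff_add_cancel)
  show "\<exists>x. y = x - E x" for y
    using *[of y] by (metis add_diff_cancel_right')
qed

context cs_module
begin

text \<open>The inverse must be adjointable, as in \<open>op_spectrum\<close>;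
  \<open>invop_of_bij\<close> obtains its adjoint by inverting the adjoint of \<open>B\<close>
  too.\<close>

definition invop :: "('h \<Rightarrow> 'h) \<Rightarrow> bool" where
  "invop B \<longleftrightarrow> (\<exists>R R'. adjpair R R' \<and> (\<forall>x. B (R x) = x) \<and> (\<forall>x. R (B x) = x))"

lemma invop_of_bij:
  assumes B: "adjpair B B'" and "bij B" "bij B'"
  shows "invop B"
proof -
  have "adjpair (inv B) (inv B')"
  proof (rule adjpairI)
    fix x y
    have "ip (inv B x) y = ip (inv B x) (B' (inv B' y))"
      using \<open>bij B'\<close> by (simp add: bij_is_surj surj_f_inv_f)
    also have "\<dots> = ip (B (inv B x)) (inv B' y)" using B by (simp add: adjpairD)
    also have "\<dots> = ip x (inv B' y)" using \<open>bij B\<close> by (simp add: bij_is_surj surj_f_inv_f)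
    finally show "ip (inv B x) y = ip x (inv B' y)" .
  qed
  then show ?thesis
    unfolding invop_def using \<open>bij B\<close>
    by (metis bij_is_surj bij_is_inj surj_f_inv_f inv_f_f)
qed

lemma invop_id_minus:
  assumes E: "adjpair E E'" and q: "q < 1" "\<And>x. norm (E x) \<le> q * norm x"
  shows "invop (\<lambda>x. x - E x)"
proof (rule invop_of_bij)
  show "adjpair (\<lambda>x. x - E x) (\<lambda>x. x - E' x)" by (intro adjpair_intros E)
  show "bij (\<lambda>x. x - E x)"
    by (rule bij_id_minus_contraction[OF bounded_linear.linear[OF adjpair_bounded_linear[OF E]] q])
  show "bij (\<lambda>x. x - E' x)"
    by (rule bij_id_minus_contraction
        [OF bounded_linear.linear[OF adjpair_bounded_linear[OF adjpair_sym[OF E]]] q(1)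
          adjpair_bound_transfer[OF E q(2)]])
qed

lemma invop_comp:
  assumes "invop A" "invop B" shows "invop (\<lambda>x. A (B x))"
proof -
  obtain R R' S S' where "adjpair R R'" "\<forall>x. A (R x) = x" "\<forall>x. R (A x) = x"
     "adjpair S S'" "\<forall>x. B (S x) = x" "\<forall>x. S (B x) = x"
    using assms unfolding invop_def by blast
  moreover from this have "adjpair (\<lambda>x. S (R x)) (\<lambda>x. R' (S' x))" using adjpair_comp[of S S' R R'] by blast
  ultimately show ?thesis
    unfolding invop_def by (intro exI[of _ "\<lambda>x. S (R x)"] exI[of _ "\<lambda>x. R' (S' x)"]) simp
qed

lemma invop_scaleC:
  assumes "c \<noteq> 0" shows "invop (\<lambda>x. c *\<^sub>C x)"
  unfolding invop_def
  by (rule exI[of _ "\<lambda>x. (1 / c) *\<^sub>C x"], rule exI[of _ "\<lambda>x. cnj (1 / c) *\<^sub>C x"])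
     (use assms adjpair_scaleC[OF adjpair_id, of "1 / c"] in \<open>auto simp: scaleC_scaleC\<close>)

lemma invop_neumann:
  assumes B: "adjpair B B'" and q: "q < cmod c" "\<And>x. norm (B x) \<le> q * norm x"
  shows "invop (\<lambda>x. c *\<^sub>C x - B x)"
proof (cases "c = 0")
  \<comment> \<open>Here \<open>q < 0\<close>, so the bound forces the zero module, where every map
    is invertible.\<close>
  case True
  then have "norm x = 0" for x :: 'h
    using q(1) order.trans[OF norm_ge_zero q(2)[of x]] by (simp add: zero_le_mult_iff)
  then have *: "x = y" for x y :: 'h by (metis norm_eq_zero)
  show ?thesis unfolding invop_def using adjpair_id * by blast
next
  case False
  have "invop (\<lambda>x. x - (1 / c) *\<^sub>C B x)"
  proof (rule invop_id_minus)
    show "norm ((1 / c) *\<^sub>C B x) \<le> (q / cmod c) * norm x" for x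
      using q(2)[of x] False by (simp add: norm_scaleC norm_divide field_simps)
  qed (use adjpair_scaleC[OF B] q False in \<open>auto simp: field_simps\<close>)
  from invop_comp[OF invop_scaleC[OF False] this] show ?thesis
    using False by (simp add: scaleC_diff_right scaleC_scaleC)
qed

lemma invop_lower_bound:
  assumes "invop B"
  obtains d where "d > 0" "\<And>x. d * norm x \<le> norm (B x)"
proof -
  obtain R R' where R: "adjpair R R'" "\<forall>x. R (B x) = x" using assms unfolding invop_def by blast
  obtain K where K: "K \<ge> 0" "\<And>x. norm (R x) \<le> K * norm x" using adjpair_bound[OF R(1)] by blast
  have "1 / (K + 1) * norm x \<le> norm (B x)" for x
  proof -
    have "norm x \<le> (K + 1) * norm (B x)"
      using K(2)[of "B x"] R(2) by (smt (verit) mult_right_mono norm_ge_zero)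
    then show ?thesis using K(1) by (simp add: field_simps)
  qed
  then show ?thesis using K(1) by (intro that[of "1 / (K + 1)"]) auto
qed

text \<open>With \<open>R\<close> the inverse of \<open>B\<close>, write
  \<open>B - E = B (1 - R E)\<close>, where \<open>R E\<close> has bound \<open>e / d < 1\<close>.
  For \<open>d \<le> 0\<close> the bound \<open>e\<close> is negative and the module is
  zero.\<close>

lemma invop_perturb:
  assumes B: "adjpair B B'" "invop B" "\<And>x. d * norm x \<le> norm (B x)"
    and E: "adjpair E E'" "\<And>x. norm (E x) \<le> e * norm x" and "e < d"
  shows "invop (\<lambda>x. B x - E x)"
proof -
  obtain R R' where R: "adjpair R R'" "\<forall>x. R (B x) = x" "\<forall>x. B (R x) = x"
    using B(2) unfolding invop_def by blast
  show ?thesis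
  proof (cases "d > 0")
    case False
    have "norm (0 :: 'h) = norm x" for x :: 'h
      using order.trans[OF norm_ge_zero E(2)[of x]] False \<open>e < d\<close> by (simp add: zero_le_mult_iff)
    then have *: "x = y" for x y :: 'h by (metis norm_eq_zero)
    show ?thesis unfolding invop_def using adjpair_id * by blast
  next
    case True
    have "invop (\<lambda>x. x - R (E x))"
    proof (rule invop_id_minus)
      show "norm (R (E x)) \<le> (e / d) * norm x" for x
        using B(3)[of "R (E x)"] E(2)[of x] R(3) True by (simp add: field_simps)
    qed (use adjpair_comp[OF R(1) E(1)] \<open>e < d\<close> True in auto)
    from invop_comp[OF B(2) this] have "invop (\<lambda>x. B (x - R (E x)))" .
    then show ?thesis
      using R(3) linear_diff[OF bounded_linear.linear[OF adjpair_bounded_linear[OF B(1)]]] by simp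
  qed
qed

text \<open>
  Shifting by \<open>w = \<i> t\<close> moves \<open>c\<close> out of the disc of radius \<open>\<parallel>B + w\<parallel> \<le> sqrt (K\<^sup>2 + t\<^sup>2)\<close>
  when \<open>2 t Im c > K\<^sup>2\<close>.
\<close>

lemma sa_invop_nonreal:
  assumes B: "sa B" and c: "Im c \<noteq> 0"
  shows "invop (\<lambda>x. c *\<^sub>C x - B x)"
proof -
  have ap: "adjpair B B" using B by (simp add: sa_def)
  interpret B: bounded_linear B using ap by (rule adjpair_bounded_linear)
  obtain K where K: "K \<ge> 0" "\<And>x. norm (B x) \<le> K * norm x" using adjpair_bound[OF ap] by blast
  define t where "t = (K\<^sup>2 + 1) / (2 * Im c)"
  define w where "w = \<i> * of_real t"
  have ap': "adjpair (\<lambda>x. B x + w *\<^sub>C x) (\<lambda>x. B x + cnj w *\<^sub>C x)"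
    by (intro adjpair_intros ap)
  have "invop (\<lambda>x. (c + w) *\<^sub>C x - (B x + w *\<^sub>C x))"
  proof (rule invop_neumann[OF ap'])
    show "norm (B x + w *\<^sub>C x) \<le> sqrt (K\<^sup>2 + t\<^sup>2) * norm x" for x
    proof (rule power2_le_imp_le)
      have "(B (B x + w *\<^sub>C x) + cnj w *\<^sub>C (B x + w *\<^sub>C x)) = B (B x) + t\<^sup>2 *\<^sub>R x"
      proof -
        have "cnj w * w = of_real (t\<^sup>2)" "cnj w = - w"
          by (simp_all add: w_def power2_eq_square complex_eq_iff)
        then show ?thesis
          by (simp add: B.add adjpair_homogeneous[OF ap] scaleC_linear scaleC_scaleC
              flip: scaleC_of_real)
      qed
      then have "(norm (B x + w *\<^sub>C x))\<^sup>2 \<le> norm x * norm (B (B x) + t\<^sup>2 *\<^sub>R x)"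
        using adjpair_norm_square[OF ap', of x] by simp
      moreover have "norm (B (B x) + t\<^sup>2 *\<^sub>R x) \<le> K * (K * norm x) + t\<^sup>2 * norm x"
        using K(2)[of "B x"] mult_left_mono[OF K(2)[of x] K(1)]
        by (intro order.trans[OF norm_triangle_ineq]) simp
      ultimately have "(norm (B x + w *\<^sub>C x))\<^sup>2 \<le> norm x * (K * (K * norm x) + t\<^sup>2 * norm x)"
        by (meson mult_left_mono norm_ge_zero order.trans)
      then show "(norm (B x + w *\<^sub>C x))\<^sup>2 \<le> (sqrt (K\<^sup>2 + t\<^sup>2) * norm x)\<^sup>2"
        by (simp add: power_mult_distrib) (simp add: power2_eq_square algebra_simps)
    qed simp
    have "(cmod (c + w))\<^sup>2 = (Re c)\<^sup>2 + (Im c)\<^sup>2 + 2 * Im c * t + t\<^sup>2"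
      by (simp add: cmod_power2 w_def) (simp add: power2_eq_square algebra_simps)
    moreover have "2 * Im c * t = K\<^sup>2 + 1" using c by (simp add: t_def)
    ultimately have "K\<^sup>2 + t\<^sup>2 < (cmod (c + w))\<^sup>2"
      using zero_le_power2[of "Re c"] zero_le_power2[of "Im c"] by linarith
    then show "sqrt (K\<^sup>2 + t\<^sup>2) < cmod (c + w)" by (simp add: real_less_lsqrt)
  qed
  then show ?thesis by (simp add: scaleC_add_left)
qed

text \<open>Invertibility is known off the real axis. At \<open>w = i d / 3\<close> the operator
  \<open>w - B\<close> keeps the lower bound \<open>2 d / 3\<close>, which exceeds
  \<open>cmod w\<close>, so returning to \<open>- B\<close> is an admissible perturbation.\<close>

lemma sa_invop_of_lower_bound:
  assumes B: "sa B" and d: "d > 0" "\<And>x. d * norm x \<le> norm (B x)"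
  shows "invop B"
proof -
  have ap: "adjpair B B" using B by (simp add: sa_def)
  interpret B: bounded_linear B using ap by (rule adjpair_bounded_linear)
  define w where "w = \<i> * of_real (d / 3)"
  have cw: "cmod w = d / 3" using d by (simp add: w_def norm_mult)
  have ap': "adjpair (\<lambda>x. w *\<^sub>C x - B x) (\<lambda>x. cnj w *\<^sub>C x - B x)"
    by (intro adjpair_intros ap)
  have "invop (\<lambda>x. (w *\<^sub>C x - B x) - w *\<^sub>C x)"
  proof (rule invop_perturb[OF ap'])
    show "invop (\<lambda>x. w *\<^sub>C x - B x)"
      by (rule sa_invop_nonreal[OF B]) (use d in \<open>simp add: w_def\<close>)
    show "(2 * d / 3) * norm x \<le> norm (w *\<^sub>C x - B x)" for x
      using d(2)[of x] norm_triangle_ineq2[of "B x" "w *\<^sub>C x"]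
      by (simp add: norm_scaleC cw norm_minus_commute)
    show "adjpair (\<lambda>x. w *\<^sub>C x) (\<lambda>x. cnj w *\<^sub>C x)" by (intro adjpair_intros)
    show "norm (w *\<^sub>C x) \<le> (d / 3) * norm x" for x by (simp add: norm_scaleC cw)
  qed (use d in simp)
  then have "invop (\<lambda>x. - B x)" by simp
  from invop_comp[OF invop_scaleC[of "-1"] this] show ?thesis
    by (simp add: scaleC_minus_left)
qed

text \<open>A lower bound \<open>d z\<close> survives as \<open>d z / 2\<close> on the disc of
  radius \<open>e z\<close>, because moving the point costs at most \<open>e z * (K + 1)\<close>.
  Compactness leaves finitely many discs.\<close>

lemma invop_uniform_lower_bound:
  assumes B: "adjpair B B'" and inv: "\<And>z. cmod z \<le> 1 \<Longrightarrow> invop (\<lambda>x. x - z *\<^sub>C B x)"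
  obtains d where "d > 0" "\<And>z x. cmod z \<le> 1 \<Longrightarrow> d * norm x \<le> norm (x - z *\<^sub>C B x)"
proof -
  obtain K where K: "K \<ge> 0" "\<And>x. norm (B x) \<le> K * norm x" using adjpair_bound[OF B] by blast
  have "\<forall>z\<in>cball 0 1. \<exists>d>0. \<forall>x. d * norm x \<le> norm (x - z *\<^sub>C B x)"
  proof
    fix z :: complex
    assume "z \<in> cball 0 1"
    then obtain d where "d > 0" "\<And>x. d * norm x \<le> norm (x - z *\<^sub>C B x)"
      using invop_lower_bound[OF inv[of z]] by (auto simp: mem_cball_0)
    then show "\<exists>d>0. \<forall>x. d * norm x \<le> norm (x - z *\<^sub>C B x)" by blast
  qed
  then obtain d where d: "\<And>z. z \<in> cball 0 1 \<Longrightarrow> d z > 0"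
    "\<And>z x. z \<in> cball 0 1 \<Longrightarrow> d z * norm x \<le> norm (x - z *\<^sub>C B x)" by metis
  define e where "e z = d z / (2 * (K + 1))" for z
  have cover: "cball 0 1 \<subseteq> (\<Union>z\<in>cball 0 1. ball z (e z))"
    using d(1) K by (auto simp: e_def intro!: bexI)
  obtain F where F: "F \<subseteq> cball 0 1" "finite F" "cball 0 1 \<subseteq> (\<Union>z\<in>F. ball z (e z))"
    by (rule compactE_image[OF compact_cball _ cover]) auto
  have "F \<noteq> {}" using F(3) by (metis UN_empty cball_eq_empty not_one_less_zero subset_empty)
  define m where "m = Min (d ` F) / 2"
  have "m > 0" using F d(1) \<open>F \<noteq> {}\<close> by (auto simp: m_def)
  moreover have "m * norm x \<le> norm (x - z *\<^sub>C B x)" if z: "cmod z \<le> 1" for z x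
  proof -
    obtain u where u: "u \<in> F" "dist u z < e u"
      using subsetD[OF F(3), of z] z by auto
    have "x - u *\<^sub>C B x = (x - z *\<^sub>C B x) + (z - u) *\<^sub>C B x" by (simp add: scaleC_diff_left)
    then have "norm (x - u *\<^sub>C B x) \<le> norm (x - z *\<^sub>C B x) + norm ((z - u) *\<^sub>C B x)"
      by (metis norm_triangle_ineq)
    moreover have "norm ((z - u) *\<^sub>C B x) \<le> e u * ((K + 1) * norm x)"
      unfolding norm_scaleC
    proof (rule mult_mono)
      show "cmod (z - u) \<le> e u" using u by (simp add: dist_norm norm_minus_commute)
      show "0 \<le> e u" using order.strict_trans1[OF zero_le_dist u(2)] by simp
      show "norm (B x) \<le> (K + 1) * norm x"
        using K(2)[of x] by (simp add: distrib_right add_increasing2)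
    qed simp
    moreover have "e u * ((K + 1) * norm x) = d u / 2 * norm x"
      using K(1) by (simp add: e_def field_simps)
    moreover have "d u * norm x \<le> norm (x - u *\<^sub>C B x)" using d(2) F(1) u(1) by blast
    ultimately have "d u * norm x \<le> norm (x - z *\<^sub>C B x) + d u / 2 * norm x" by linarith
    then have "d u / 2 * norm x \<le> norm (x - z *\<^sub>C B x)" by simp
    moreover have "m \<le> d u / 2" using F(2) u(1) by (simp add: m_def)
    ultimately show ?thesis by (meson mult_right_mono norm_ge_zero order.trans)
  qed
  ultimately show ?thesis using that by blast
qed

text \<open>The gap \<open>\<epsilon>\<close> is averaged, not multiplied, so it does not
  deteriorate under repeated squaring; only the ratio \<open>s\<close> of the two points
  changes.\<close>

lemma resolvent_gap_square:
  fixes Q :: "'h \<Rightarrow> 'h"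
  assumes Q: "adjpair Q Q'"
    and gap: "\<And>z. cmod z \<le> 1 \<Longrightarrow> \<exists>G H.
      (\<forall>x. G x - z *\<^sub>C Q (G x) = x \<and> G (x - z *\<^sub>C Q x) = x) \<and>
      (\<forall>x. H x - (s * z) *\<^sub>C Q (H x) = x \<and> H (x - (s * z) *\<^sub>C Q x) = x) \<and>
      (\<forall>x. norm (G x - H x) \<le> \<epsilon> * norm x)"
    and z: "cmod z \<le> 1"
  shows "\<exists>G H.
      (\<forall>x. G x - z *\<^sub>C Q (Q (G x)) = x \<and> G (x - z *\<^sub>C Q (Q x)) = x) \<and>
      (\<forall>x. H x - (s\<^sup>2 * z) *\<^sub>C Q (Q (H x)) = x \<and> H (x - (s\<^sup>2 * z) *\<^sub>C Q (Q x)) = x) \<and>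
      (\<forall>x. norm (G x - H x) \<le> \<epsilon> * norm x)"
proof -
  interpret Q: bounded_linear Q using Q by (rule adjpair_bounded_linear)
  note Qs = adjpair_homogeneous[OF Q]
  \<comment> \<open>\<open>(1 - w\<^sup>2 Q\<^sup>2)\<^sup>-\<^sup>1\<close> is the mean of \<open>(1 - w Q)\<^sup>-\<^sup>1\<close> and \<open>(1 + w Q)\<^sup>-\<^sup>1\<close>.\<close>
  have mean: "(1/2) *\<^sub>R (G x + H x) - (w * w) *\<^sub>C Q (Q ((1/2) *\<^sub>R (G x + H x))) = x \<and>
      (1/2) *\<^sub>R (G (x - (w * w) *\<^sub>C Q (Q x)) + H (x - (w * w) *\<^sub>C Q (Q x))) = x"
    if G: "\<And>x. G x - w *\<^sub>C Q (G x) = x \<and> G (x - w *\<^sub>C Q x) = x"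
    and H: "\<And>x. H x + w *\<^sub>C Q (H x) = x \<and> H (x + w *\<^sub>C Q x) = x" for G H w x
  proof
    have g: "G x - (w * w) *\<^sub>C Q (Q (G x)) = x + w *\<^sub>C Q x"
    proof -
      have "x + w *\<^sub>C Q x = (G x - w *\<^sub>C Q (G x)) + w *\<^sub>C Q (G x - w *\<^sub>C Q (G x))"
        using G by simp
      then show ?thesis by (simp add: Q.diff Qs scaleC_linear scaleC_scaleC)
    qed
    have h: "H x - (w * w) *\<^sub>C Q (Q (H x)) = x - w *\<^sub>C Q x"
    proof -
      have "x - w *\<^sub>C Q x = (H x + w *\<^sub>C Q (H x)) - w *\<^sub>C Q (H x + w *\<^sub>C Q (H x))"
        using H by simp
      then show ?thesis by (simp add: Q.add Qs scaleC_linear scaleC_scaleC)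
    qed
    have "(1/2) *\<^sub>R (G x + H x) - (w * w) *\<^sub>C Q (Q ((1/2) *\<^sub>R (G x + H x)))
       = (1/2) *\<^sub>R ((G x - (w * w) *\<^sub>C Q (Q (G x))) + (H x - (w * w) *\<^sub>C Q (Q (H x))))"
      by (simp add: Q.add Q.scaleR scaleC_linear scaleC_scaleR scaleR_scaleC algebra_simps)
    then show "(1/2) *\<^sub>R (G x + H x) - (w * w) *\<^sub>C Q (Q ((1/2) *\<^sub>R (G x + H x))) = x"
      unfolding g h by (simp flip: scaleR_2)
    have "G (x - (w * w) *\<^sub>C Q (Q x)) = x + w *\<^sub>C Q x"
      using conjunct2[OF G[of "x + w *\<^sub>C Q x"]]
      by (simp add: Q.add Qs scaleC_linear scaleC_scaleC)
    moreover have "H (x - (w * w) *\<^sub>C Q (Q x)) = x - w *\<^sub>C Q x"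
      using conjunct2[OF H[of "x - w *\<^sub>C Q x"]]
      by (simp add: Q.diff Qs scaleC_linear scaleC_scaleC)
    ultimately show "(1/2) *\<^sub>R (G (x - (w * w) *\<^sub>C Q (Q x)) + H (x - (w * w) *\<^sub>C Q (Q x))) = x"
      by (simp flip: scaleR_2)
  qed
  define w where "w = csqrt z"
  have w: "w * w = z" "cmod w \<le> 1" "cmod (- w) \<le> 1"
    using z by (simp_all add: w_def flip: power2_eq_square)
  obtain G1 H1 where one: "\<And>x. G1 x - w *\<^sub>C Q (G1 x) = x \<and> G1 (x - w *\<^sub>C Q x) = x"
      "\<And>x. H1 x - (s * w) *\<^sub>C Q (H1 x) = x \<and> H1 (x - (s * w) *\<^sub>C Q x) = x"
      "\<And>x. norm (G1 x - H1 x) \<le> \<epsilon> * norm x"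
    using gap[OF w(2)] by blast
  obtain G2 H2 where two: "\<And>x. G2 x - (- w) *\<^sub>C Q (G2 x) = x \<and> G2 (x - (- w) *\<^sub>C Q x) = x"
      "\<And>x. H2 x - (s * (- w)) *\<^sub>C Q (H2 x) = x \<and> H2 (x - (s * (- w)) *\<^sub>C Q x) = x"
      "\<And>x. norm (G2 x - H2 x) \<le> \<epsilon> * norm x"
    using gap[OF w(3)] by blast
  have sw: "(s * w) * (s * w) = s\<^sup>2 * z" using w(1) by (simp add: power2_eq_square algebra_simps)
  show ?thesis
  proof (rule exI[of _ "\<lambda>x. (1/2) *\<^sub>R (G1 x + G2 x)"],
      rule exI[of _ "\<lambda>x. (1/2) *\<^sub>R (H1 x + H2 x)"], intro conjI allI)
    fix x
    have two': "\<And>x. G2 x + w *\<^sub>C Q (G2 x) = x \<and> G2 (x + w *\<^sub>C Q x) = x"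
       "\<And>x. H2 x + (s * w) *\<^sub>C Q (H2 x) = x \<and> H2 (x + (s * w) *\<^sub>C Q x) = x"
      using two(1,2) by (simp_all add: scaleC_minus_left)
    note G = mean[of G1 w G2 x, unfolded w(1), OF one(1) two'(1)]
    note H = mean[of H1 "s * w" H2 x, unfolded sw, OF one(2) two'(2)]
    show "(1/2) *\<^sub>R (G1 x + G2 x) - z *\<^sub>C Q (Q ((1/2) *\<^sub>R (G1 x + G2 x))) = x" using G by blast
    show "(1/2) *\<^sub>R (G1 (x - z *\<^sub>C Q (Q x)) + G2 (x - z *\<^sub>C Q (Q x))) = x" using G by blast
    show "(1/2) *\<^sub>R (H1 x + H2 x) - (s\<^sup>2 * z) *\<^sub>C Q (Q ((1/2) *\<^sub>R (H1 x + H2 x))) = x" using H by blast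
    show "(1/2) *\<^sub>R (H1 (x - (s\<^sup>2 * z) *\<^sub>C Q (Q x)) + H2 (x - (s\<^sup>2 * z) *\<^sub>C Q (Q x))) = x"
      using H by blast
    have "norm ((1/2) *\<^sub>R (G1 x + G2 x) - (1/2) *\<^sub>R (H1 x + H2 x))
        = norm ((1/2) *\<^sub>R ((G1 x - H1 x) + (G2 x - H2 x)))"
      by (simp add: algebra_simps)
    also have "\<dots> \<le> \<epsilon> * norm x"
      using norm_triangle_ineq[of "G1 x - H1 x" "G2 x - H2 x"] one(3)[of x] two(3)[of x] by simp
    finally show "norm ((1/2) *\<^sub>R (G1 x + G2 x) - (1/2) *\<^sub>R (H1 x + H2 x)) \<le> \<epsilon> * norm x" .
  qed
qed

text \<open>
  The resolvents at \<open>z\<close> and \<open>r z\<close>, for \<open>r < 1\<close> close to \<open>1\<close>, are uniformly close. Passing from \<open>B\<close> to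
  \<open>B\<^sup>2\<close> preserves the distance but replaces \<open>r\<close> by \<open>r\<^sup>2\<close>, so eventually \<open>(1 - B\<^sup>n)\<^sup>-\<^sup>1\<close> is close to \<open>1\<close>.
\<close>

lemma power_contraction_of_resolvent:
  assumes B: "adjpair B B'" "\<And>x. norm (B x) \<le> norm x"
    and inv: "\<And>z. cmod z \<le> 1 \<Longrightarrow> invop (\<lambda>x. x - z *\<^sub>C B x)"
  obtains k where "\<And>x. norm ((B ^^ (2 ^ k)) x) \<le> 3/5 * norm x"
proof -
  interpret B: bounded_linear B using B(1) by (rule adjpair_bounded_linear)
  obtain d0 where d0: "d0 > 0" "\<And>z x. cmod z \<le> 1 \<Longrightarrow> d0 * norm x \<le> norm (x - z *\<^sub>C B x)"
    using invop_uniform_lower_bound[OF B(1) inv] by blast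
  define d where "d = min d0 1"
  have lower: "d * norm x \<le> norm (x - z *\<^sub>C B x)" if "cmod z \<le> 1" for z x
    using order.trans[OF mult_right_mono d0(2)[OF that]] by (auto simp: d_def)
  have d: "d > 0" "d \<le> 1" using d0(1) by (auto simp: d_def)
  \<comment> \<open>The resolvent identity loses one factor \<open>1 / d\<close> for each of the two
    resolvents, so \<open>1 - r = d^2 / 8\<close> produces the gap 1/8. The cap
    \<open>d \<le> 1\<close> keeps \<open>r\<close> nonnegative.\<close>
  define r where "r = 1 - d\<^sup>2 / 8"
  have "d\<^sup>2 \<le> 1" "d\<^sup>2 > 0" using d by (auto simp: power_le_one)
  then have r: "0 \<le> r" "r < 1" by (auto simp: r_def)
  have gap: "\<exists>G H.
      (\<forall>x. G x - z *\<^sub>C (B ^^ (2 ^ k)) (G x) = x \<and> G (x - z *\<^sub>C (B ^^ (2 ^ k)) x) = x) \<and>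
      (\<forall>x. H x - (of_real (r ^ (2 ^ k)) * z) *\<^sub>C (B ^^ (2 ^ k)) (H x) = x \<and>
            H (x - (of_real (r ^ (2 ^ k)) * z) *\<^sub>C (B ^^ (2 ^ k)) x) = x) \<and>
      (\<forall>x. norm (G x - H x) \<le> 1/8 * norm x)" if "cmod z \<le> 1" for z k
    using that
  proof (induction k arbitrary: z)
    case 0
    have rz: "cmod (of_real r * z) \<le> 1" using 0 r by (simp add: norm_mult mult_le_one)
    obtain G where G: "\<And>x. G x - z *\<^sub>C B (G x) = x" "\<And>x. G (x - z *\<^sub>C B x) = x"
      using inv[OF 0] unfolding invop_def by blast
    obtain H where H: "\<And>x. H x - (of_real r * z) *\<^sub>C B (H x) = x"
        "\<And>x. H (x - (of_real r * z) *\<^sub>C B x) = x"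
      using inv[OF rz] unfolding invop_def by blast
    have "norm (G x - H x) \<le> 1/8 * norm x" for x
    proof -
      have *: "(G x - H x) - z *\<^sub>C B (G x - H x) = (of_real (1 - r) * z) *\<^sub>C B (H x)"
      proof -
        have "(G x - H x) - z *\<^sub>C B (G x - H x)
          = (G x - z *\<^sub>C B (G x)) - (H x - (of_real r * z) *\<^sub>C B (H x)) + (of_real (1 - r) * z) *\<^sub>C B (H x)"
          by (simp add: B.diff scaleC_linear left_diff_distrib)
        then show ?thesis using G(1) H(1) by simp
      qed
      have "d * norm (G x - H x) \<le> norm ((of_real (1 - r) * z) *\<^sub>C B (H x))"
        using lower[OF 0, of "G x - H x"] by (simp add: *)
      also have "\<dots> \<le> (1 - r) * norm (H x)"
      proof -
        have "cmod z * norm (B (H x)) \<le> 1 * norm (H x)"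
          by (rule mult_mono) (use 0 B(2) in auto)
        then show ?thesis
          using r by (simp add: norm_scaleC norm_mult mult.assoc mult_left_mono del: of_real_diff)
      qed
      finally have "d * (d * norm (G x - H x)) \<le> d * ((1 - r) * norm (H x))"
        using d by simp
      also have "\<dots> = (1 - r) * (d * norm (H x))" by simp
      also have "\<dots> \<le> (1 - r) * norm x"
        using lower[OF rz, of "H x"] r by (intro mult_left_mono) (simp_all add: H(1))
      finally show ?thesis using d by (simp add: r_def power2_eq_square)
    qed
    then show ?case using G H by (intro exI[of _ G] exI[of _ H]) simp
  next
    case (Suc k)
    have ap: "adjpair (B ^^ (2 ^ k)) (B' ^^ (2 ^ k))" by (rule adjpair_funpow[OF B(1)])
    have *: "(B ^^ (2 ^ Suc k)) x = (B ^^ (2 ^ k)) ((B ^^ (2 ^ k)) x)" for x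
      by (simp add: mult_2 funpow_add)
    have **: "complex_of_real (r ^ (2 ^ Suc k)) = (of_real (r ^ (2 ^ k)))\<^sup>2"
      by (simp add: mult.commute[of 2] flip: power_mult)
    show ?case
      unfolding * ** by (rule resolvent_gap_square[OF ap Suc.IH Suc.prems])
  qed
  obtain n where n: "r ^ n < 1/5" using r real_arch_pow_inv[of "1/5" r] by auto
  have "r ^ (2 ^ n) \<le> r ^ n" using r by (intro power_decreasing) auto
  define s where "s = r ^ (2 ^ n)"
  define Q where "Q = B ^^ (2 ^ n)"
  have s: "0 \<le> s" "s < 1/5" using n \<open>r ^ (2 ^ n) \<le> r ^ n\<close> r by (auto simp: s_def)
  have Q1: "norm (Q x) \<le> norm x" for x
  proof -
    have "norm ((B ^^ m) x) \<le> norm x" for m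
      by (induction m) (auto intro: order.trans[OF B(2)])
    then show ?thesis by (simp add: Q_def)
  qed
  obtain G H where GH: "\<And>x. G (x - Q x) = x"
     "\<And>x. H x - of_real s *\<^sub>C Q (H x) = x"  "\<And>x. norm (G x - H x) \<le> 1/8 * norm x"
    using gap[of 1 n] by (auto simp: s_def Q_def)
  \<comment> \<open>From \<open>s < 1/5\<close>, \<open>y\<close> differs from \<open>x\<close> by
    at most \<open>norm x / 4\<close>. Adding the gap 1/8 gives
    \<open>norm (Q u) = norm (u - x) \<le> 3/8 * norm x\<close>, and
    \<open>norm x \<le> norm u + norm (Q u)\<close> turns 3/8 into (3/8) / (5/8) = 3/5.\<close>
  have "norm (Q u) \<le> 3/5 * norm u" for u
  proof -
    define x where "x = u - Q u"
    define y where "y = H x"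
    have "norm (s *\<^sub>R Q y) \<le> 1/5 * norm y"
      using mult_mono[of s "1/5" "norm (Q y)" "norm y"] s Q1[of y] by simp
    moreover have yx: "y = x + s *\<^sub>R Q y" using GH(2)[of x] by (simp add: y_def scaleC_of_real algebra_simps)
    ultimately have "norm (y - x) \<le> 1/5 * norm y" "norm y \<le> norm x + 1/5 * norm y"
      using norm_triangle_ineq[of x "s *\<^sub>R Q y"] by (metis add_diff_cancel_left', simp)
    moreover have "norm (u - y) \<le> 1/8 * norm x" using GH(1)[of u] GH(3)[of x] by (simp add: x_def y_def)
    moreover have "norm (u - x) \<le> norm (u - y) + norm (y - x)"
      using norm_triangle_ineq[of "u - y" "y - x"] by simp
    moreover have "u - x = Q u" by (simp add: x_def)
    moreover have "norm x \<le> norm u + norm (Q u)" by (simp add: x_def norm_triangle_ineq4)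
    ultimately show ?thesis by simp
  qed
  then show ?thesis unfolding Q_def by (rule that)
qed

end

section \<open>Norm bounds of self-adjoint operators from their spectrum\<close>

context cs_module
begin

lemma invop_scaleR: "r \<noteq> 0 \<Longrightarrow> invop (\<lambda>x. r *\<^sub>R x)"
  using invop_scaleC[of "of_real r"] by (simp add: scaleC_of_real)

text \<open>In terms of the spectral point \<open>K / z\<close>, self-adjointness settles nonreal
  \<open>z\<close> and the Neumann series settles \<open>cmod z < 1\<close>. Only
  \<open>z = 1\<close> and \<open>z = -1\<close> remain, and these are the two assumptions
  \<open>inv\<close>.\<close>

lemma sa_invop_scaled:
  assumes B: "sa B" and K: "K > 0" "\<And>x. norm (B x) \<le> K * norm x"
    and inv: "invop (\<lambda>x. K *\<^sub>R x - B x)" "invop (\<lambda>x. K *\<^sub>R x + B x)"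
    and z: "cmod z \<le> 1"
  shows "invop (\<lambda>x. x - z *\<^sub>C ((1 / K) *\<^sub>R B x))"
proof -
  have ap: "adjpair B B" using B by (simp add: sa_def)
  have lift: "invop (\<lambda>x. x - z *\<^sub>C ((1 / K) *\<^sub>R B x))"
    if "z \<noteq> 0" "invop (\<lambda>x. (of_real K / z) *\<^sub>C x - B x)"
  proof -
    have "invop (\<lambda>x. (z / of_real K) *\<^sub>C ((of_real K / z) *\<^sub>C x - B x))"
      using invop_comp[OF invop_scaleC[of "z / of_real K"] that(2)] that(1) K(1) by simp
    then show ?thesis
      using that(1) K(1) by (simp add: scaleC_diff_right scaleC_scaleC scaleC_scaleR)
  qed
  consider "z = 0" | "z \<noteq> 0" "Im z \<noteq> 0" | "z \<noteq> 0" "cmod z < 1" | "z = 1" | "z = -1"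
  proof -
    have "z = 1 \<or> z = -1" if "Im z = 0" "cmod z = 1"
      using that by (auto simp: complex_eq_iff cmod_def)
    then show ?thesis using z that by (metis le_less)
  qed
  then show ?thesis
  proof cases
    case 1
    then show ?thesis using invop_scaleC[of 1] by simp
  next
    case 2
    have "Im (of_real K / z) \<noteq> 0"
      using 2 K(1) by (simp add: Im_divide sum_power2_eq_zero_iff)
    then show ?thesis using 2 B by (intro lift sa_invop_nonreal)
  next
    case 3
    have "K < cmod (of_real K / z)" using 3 K(1) by (simp add: norm_divide less_divide_eq)
    then show ?thesis using 3 by (intro lift invop_neumann[OF ap _ K(2)])
  next
    case 4
    then show ?thesis using inv(1) by (intro lift) (simp_all add: scaleC_of_real)
  next
    case 5
    have "invop (\<lambda>x. -1 *\<^sub>C (K *\<^sub>R x + B x))"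
      using invop_comp[OF invop_scaleC[of "-1"] inv(2)] by simp
    then have "invop (\<lambda>x. - (K *\<^sub>R x) - B x)"
      by (simp add: scaleC_minus_left)
    then show ?thesis using 5 by (intro lift) (simp_all add: scaleC_minus_left scaleC_of_real)
  qed
qed

text \<open>Some power \<open>2 ^ k\<close> of \<open>B / K\<close> contracts by 3/5.
  Self-adjointness transfers this to \<open>B / K\<close> itself with the \<open>2 ^ k\<close>-th
  root of 3/5, which is below 1.\<close>

lemma sa_bound_improve:
  assumes B: "sa B" and K: "K > 0" "\<And>x. norm (B x) \<le> K * norm x"
    and inv: "invop (\<lambda>x. K *\<^sub>R x - B x)" "invop (\<lambda>x. K *\<^sub>R x + B x)"
  obtains K' where "0 \<le> K'" "K' < K" "\<And>x. norm (B x) \<le> K' * norm x"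
proof -
  have ap: "adjpair B B" using B by (simp add: sa_def)
  define B1 where "B1 = (\<lambda>x. (1 / K) *\<^sub>R B x)"
  have ap1: "adjpair B1 B1" unfolding B1_def by (intro adjpair_intros ap)
  have b1: "norm (B1 x) \<le> norm x" for x
    using K(1) K(2)[of x] by (simp add: B1_def field_simps)
  have inv1: "invop (\<lambda>x. x - z *\<^sub>C B1 x)" if "cmod z \<le> 1" for z
    unfolding B1_def by (rule sa_invop_scaled[OF B K inv that])
  obtain k where k: "\<And>x. norm ((B1 ^^ (2 ^ k)) x) \<le> 3/5 * norm x"
    using power_contraction_of_resolvent[OF ap1 b1 inv1] by blast
  define q :: real where "q = root (2 ^ k) (3/5)"
  have q: "q \<ge> 0" "q < 1" "q ^ (2 ^ k) = 3/5" by (simp_all add: q_def)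
  have "norm (B1 x) \<le> q * norm x" for x
    using sa_bound_of_power[of B1 q k x] k q ap1 by (simp add: sa_def)
  then have "norm (B x) \<le> (q * K) * norm x" for x
    using K(1) by (simp add: B1_def field_simps)
  then show ?thesis using q K(1) by (intro that[of "q * K"]) auto
qed

text \<open>The operator norm is a least bound, so it cannot exceed \<open>M\<close>:
  \<open>sa_bound_improve\<close> would supply a smaller one.\<close>

lemma sa_bound_of_spectrum:
  assumes B: "sa B" and "M \<ge> 0"
    and inv: "\<And>r. r > M \<Longrightarrow> invop (\<lambda>x. r *\<^sub>R x - B x)" "\<And>r. r > M \<Longrightarrow> invop (\<lambda>x. r *\<^sub>R x + B x)"
  shows "norm (B x) \<le> M * norm x"
proof -
  have bl: "bounded_linear B" using B adjpair_bounded_linear by (auto simp: sa_def)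
  have N: "norm (B x) \<le> onorm B * norm x" for x by (rule onorm[OF bl])
  have "onorm B \<le> M"
  proof (rule ccontr)
    assume "\<not> onorm B \<le> M"
    then have "onorm B > M" "onorm B > 0" using \<open>M \<ge> 0\<close> by auto
    then obtain K' where "0 \<le> K'" "K' < onorm B" "\<And>x. norm (B x) \<le> K' * norm x"
      using sa_bound_improve[OF B _ N] inv by blast
    then show False using onorm_bound[of K' B] by auto
  qed
  then show ?thesis using N[of x] by (meson mult_right_mono norm_ge_zero order.trans)
qed

section \<open>Positive operators and square roots\<close>

text \<open>The spectrum of a self-adjoint operator is real, so excluding every \<open>- s\<close>
  with \<open>s > 0\<close> amounts to \<open>op_positive\<close>; see
  \<open>op_positive_iff_pos\<close>.\<close>

definition pos :: "('h \<Rightarrow> 'h) \<Rightarrow> bool" where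
  "pos R \<longleftrightarrow> sa R \<and> (\<forall>s>0. invop (\<lambda>x. s *\<^sub>R x + R x))"

lemma pos_sa: "pos R \<Longrightarrow> sa R"
  by (simp add: pos_def)

lemma pos_of_bound:
  assumes R: "sa R" and M: "M \<ge> 0" "\<And>x. norm (M *\<^sub>R x - R x) \<le> M * norm x"
  shows "pos R"
  unfolding pos_def
proof (intro conjI allI impI R)
  fix s :: real
  assume "s > 0"
  have ap: "adjpair (\<lambda>x. M *\<^sub>R x - R x) (\<lambda>x. M *\<^sub>R x - R x)"
    using R unfolding sa_def by (intro adjpair_intros)
  have "invop (\<lambda>x. of_real (s + M) *\<^sub>C x - (M *\<^sub>R x - R x))"
    by (rule invop_neumann[OF ap _ M(2)]) (use M(1) \<open>s > 0\<close> in \<open>simp del: of_real_add\<close>)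
  then show "invop (\<lambda>x. s *\<^sub>R x + R x)"
    by (simp add: scaleC_of_real algebra_simps del: of_real_add)
qed

text \<open>For \<open>r > M\<close>, the operator \<open>r - (M - R) = (r - M) + R\<close> is
  invertible by positivity and \<open>r + (M - R) = (r + M) - R\<close> by the Neumann
  series.\<close>

lemma pos_bound:
  assumes R: "pos R" and M: "M \<ge> 0" "\<And>x. norm (R x) \<le> M * norm x"
  shows "norm (M *\<^sub>R x - R x) \<le> M * norm x"
proof (rule sa_bound_of_spectrum[OF _ M(1)])
  have ap: "adjpair R R" using R by (simp add: pos_def sa_def)
  show "sa (\<lambda>x. M *\<^sub>R x - R x)" unfolding sa_def by (intro adjpair_intros ap)
  fix r assume "r > M"
  then show "invop (\<lambda>x. r *\<^sub>R x - (M *\<^sub>R x - R x))"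
    using R[unfolded pos_def] by (auto simp: algebra_simps dest!: spec[of _ "r - M"])
  have "invop (\<lambda>x. of_real (r + M) *\<^sub>C x - R x)"
    by (rule invop_neumann[OF ap _ M(2)]) (use M(1) \<open>r > M\<close> in \<open>simp del: of_real_add\<close>)
  then show "invop (\<lambda>x. r *\<^sub>R x + (M *\<^sub>R x - R x))"
    by (simp add: scaleC_of_real algebra_simps del: of_real_add)
qed

lemma pos_obtain_bound:
  assumes "pos R"
  obtains M where "M > 0" "\<And>x. norm (M *\<^sub>R x - R x) \<le> M * norm x"
proof -
  obtain K where K: "K \<ge> 0" "\<And>x. norm (R x) \<le> K * norm x"
    using assms adjpair_bound by (metis pos_def sa_def)
  have "norm (R x) \<le> (K + 1) * norm x" for x
    using K(2)[of x] by (simp add: distrib_right add_increasing2)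
  then show ?thesis using K(1) pos_bound[OF assms] by (intro that[of "K + 1"]) auto
qed

text \<open>In the norm form of positivity this is the triangle inequality.\<close>

lemma pos_add:
  assumes "pos R" "pos Q" shows "pos (\<lambda>x. R x + Q x)"
proof -
  obtain M N where M: "M > 0" "\<And>x. norm (M *\<^sub>R x - R x) \<le> M * norm x"
    and N: "N > 0" "\<And>x. norm (N *\<^sub>R x - Q x) \<le> N * norm x"
    using assms pos_obtain_bound by metis
  show ?thesis
  proof (rule pos_of_bound)
    show "sa (\<lambda>x. R x + Q x)" using assms unfolding pos_def sa_def by (intro adjpair_intros) auto
    show "norm ((M + N) *\<^sub>R x - (R x + Q x)) \<le> (M + N) * norm x" for x
    proof -
      have "(M + N) *\<^sub>R x - (R x + Q x) = (M *\<^sub>R x - R x) + (N *\<^sub>R x - Q x)"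
        by (simp add: algebra_simps)
      then show ?thesis
        using norm_triangle_mono[OF M(2)[of x] N(2)[of x]] by (simp only: distrib_right)
    qed
  qed (use M N in simp)
qed

text \<open>\<open>s + R R\<close> factors as \<open>(w - R) (- w - R)\<close> with
  \<open>w = i sqrt s\<close>, and both factors are invertible off the real axis.\<close>

lemma pos_square:
  assumes R: "sa R" shows "pos (\<lambda>x. R (R x))"
  unfolding pos_def
proof (intro conjI allI impI)
  have ap: "adjpair R R" using R by (simp add: sa_def)
  interpret R: bounded_linear R using ap by (rule adjpair_bounded_linear)
  show "sa (\<lambda>x. R (R x))" unfolding sa_def by (rule adjpair_comp[OF ap ap])
  fix s :: real
  assume "s > 0"
  define w where "w = \<i> * of_real (sqrt s)"
  have w: "w * w = of_real (- s)"
    using \<open>s > 0\<close> by (simp add: w_def complex_eq_iff)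
  have "Im w \<noteq> 0" "Im (- w) \<noteq> 0" using \<open>s > 0\<close> by (simp_all add: w_def)
  then have "invop (\<lambda>x. w *\<^sub>C x - R x)" "invop (\<lambda>x. (- w) *\<^sub>C x - R x)"
    using sa_invop_nonreal[OF R] by blast+
  from invop_comp[OF this]
  have "invop (\<lambda>x. w *\<^sub>C ((- w) *\<^sub>C x - R x) - R ((- w) *\<^sub>C x - R x))" .
  moreover have "w *\<^sub>C ((- w) *\<^sub>C x - R x) - R ((- w) *\<^sub>C x - R x) = s *\<^sub>R x + R (R x)" for x
  proof -
    have "w *\<^sub>C ((- w) *\<^sub>C x - R x) - R ((- w) *\<^sub>C x - R x) = - ((w * w) *\<^sub>C x) + R (R x)"
      by (simp add: R.diff R.add linear_neg[OF R.linear_axioms] adjpair_homogeneous[OF ap] scaleC_linear scaleC_scaleC)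
    then show ?thesis unfolding w scaleC_of_real by simp
  qed
  ultimately show "invop (\<lambda>x. s *\<^sub>R x + R (R x))" by simp
qed

text \<open>\<open>N - Z\<close> is the sum of the positive operators \<open>N - (Z + W)\<close> and
  \<open>W\<close>, so \<open>Z\<close> has no spectrum above \<open>N\<close>.\<close>

lemma pos_norm_mono:
  assumes Z: "pos Z" and W: "pos W" and N: "N \<ge> 0" "\<And>x. norm (Z x + W x) \<le> N * norm x"
  shows "norm (Z x) \<le> N * norm x"
proof (rule sa_bound_of_spectrum[OF pos_sa[OF Z] N(1)])
  fix r assume r: "r > N"
  have "pos (\<lambda>x. N *\<^sub>R x - (Z x + W x))"
  proof (rule pos_of_bound[OF _ N(1)])
    show "sa (\<lambda>x. N *\<^sub>R x - (Z x + W x))"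
      using Z W unfolding pos_def sa_def by (intro adjpair_intros) auto
    show "norm (N *\<^sub>R x - (N *\<^sub>R x - (Z x + W x))) \<le> N * norm x" for x using N(2)[of x] by (simp add: add.commute)
  qed
  from pos_add[OF this W] have "pos (\<lambda>x. N *\<^sub>R x - Z x)" by (simp add: algebra_simps)
  then have "invop (\<lambda>x. (r - N) *\<^sub>R x + (N *\<^sub>R x - Z x))" using r by (simp add: pos_def)
  then show "invop (\<lambda>x. r *\<^sub>R x - Z x)" by (simp add: algebra_simps)
  show "invop (\<lambda>x. r *\<^sub>R x + Z x)" using Z r N(1) by (simp add: pos_def)
qed

lemma pos_antisym:
  assumes "pos Z" "pos (\<lambda>x. - Z x)" shows "Z x = 0"
  using pos_norm_mono[OF assms, of 0 x] by simp

text \<open>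
  \<open>1 - Y\<close> is the square root of \<open>1 - X\<close>. The scalar sequence \<open>y\<close>, which is the case \<open>X = 1\<close> of the
  iteration, majorizes its increments.
\<close>

lemma sqrt_of_contraction:
  assumes X: "sa X" "\<And>x. norm (X x) \<le> norm x"
  shows "\<exists>Y. sa Y \<and> (\<forall>x. norm (Y x) \<le> norm x) \<and> (\<forall>x. X x = 2 *\<^sub>R Y x - Y (Y x)) \<and>
    (\<forall>C C'. adjpair C C' \<longrightarrow> (\<forall>x. C (X x) = X (C x)) \<longrightarrow> (\<forall>x. C (Y x) = Y (C x)))"
proof -
  have apX: "adjpair X X" using X(1) by (simp add: sa_def)
  define Y where "Y = rec_nat (\<lambda>x::'h. 0) (\<lambda>_ Z x. (1/2) *\<^sub>R (X x + Z (Z x)))"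
  have Y: "Y 0 = (\<lambda>x. 0)" "\<And>n. Y (Suc n) = (\<lambda>x. (1/2) *\<^sub>R (X x + Y n (Y n x)))"
    by (simp_all add: Y_def)
  define y where "y = rec_nat (0::real) (\<lambda>_ z. (1 + z * z) / 2)"
  have y: "y 0 = 0" "\<And>n. y (Suc n) = (1 + y n * y n) / 2" by (simp_all add: y_def)
  have y01: "0 \<le> y n \<and> y n \<le> 1" for n
  proof (induction n)
    case (Suc n)
    then have "y n * y n \<le> 1" by (simp add: mult_le_one)
    then show ?case using Suc by (simp add: y)
  qed (simp add: y)
  have ystep: "y n \<le> y (Suc n)" for n
  proof -
    have "0 \<le> (1 - y n) * (1 - y n)" by simp
    then show ?thesis by (simp add: y algebra_simps)
  qed
  have apY: "adjpair (Y n) (Y n)" for n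
  proof (induction n)
    case 0 show ?case by (simp add: Y adjpair_def ip.zero_left ip.zero_right)
  next
    case (Suc n)
    show ?case unfolding Y by (intro adjpair_intros apX adjpair_comp[OF Suc Suc])
  qed
  have addY: "Y n (u - v) = Y n u - Y n v" for n u v
    using linear_diff[OF bounded_linear.linear[OF adjpair_bounded_linear[OF apY]]] .
  have normY: "norm (Y n x) \<le> y n * norm x" for n x
  proof (induction n arbitrary: x)
    case (Suc n)
    have "norm (Y n (Y n x)) \<le> y n * (y n * norm x)"
      using Suc[of "Y n x"] mult_left_mono[OF Suc[of x]] y01[of n] by (meson order.trans)
    then have "norm (X x + Y n (Y n x)) \<le> norm x + y n * (y n * norm x)"
      using X(2)[of x] norm_triangle_mono by blast
    then show ?case by (simp add: Y y del: scaleR_add_right) (simp add: algebra_simps)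
  qed (simp add: Y y)
  have stepY: "norm (Y (Suc n) x - Y n x) \<le> (y (Suc n) - y n) * norm x" for n x
  proof (induction n arbitrary: x)
    case 0
    show ?case using X(2)[of x] by (simp add: Y y)
  next
    case (Suc n)
    let ?D = "\<lambda>x. Y (Suc n) x - Y n x"
    \<comment> \<open>The difference of the squares of \<open>Y (Suc n)\<close> and
      \<open>Y n\<close> is split as \<open>D Y (Suc n) + Y n D\<close>, an identity that does not
      rely on commutation.\<close>
    have eq: "Y (Suc (Suc n)) x - Y (Suc n) x = (1/2) *\<^sub>R (?D (Y (Suc n) x) + Y n (?D x))"
      by (subst (1 2) Y(2)) (simp add: addY algebra_simps)
    have "norm (?D (Y (Suc n) x)) \<le> (y (Suc n) - y n) * (y (Suc n) * norm x)"
      using Suc[of "Y (Suc n) x"] mult_left_mono[OF normY[of "Suc n" x]] ystep[of n]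
      by (meson diff_ge_0_iff_ge order.trans)
    moreover have "norm (Y n (?D x)) \<le> y n * ((y (Suc n) - y n) * norm x)"
      using normY[of n "?D x"] mult_left_mono[OF Suc[of x]] y01[of n] by (meson order.trans)
    ultimately have "norm (?D (Y (Suc n) x) + Y n (?D x))
        \<le> (y (Suc n) - y n) * (y (Suc n) * norm x) + y n * ((y (Suc n) - y n) * norm x)"
      by (meson add_mono norm_triangle_le)
    also have "\<dots> = 2 * ((y (Suc (Suc n)) - y (Suc n)) * norm x)"
      by (subst y(2)[of "Suc n"], subst (5) y(2)[of n]) (simp add: algebra_simps)
    finally show ?case unfolding eq by simp
  qed
  have gapY: "norm (Y (n + k) x - Y n x) \<le> (y (n + k) - y n) * norm x" for n k x
  proof (induction k)
    case (Suc k)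
    have "Y (n + Suc k) x - Y n x = (Y (Suc (n + k)) x - Y (n + k) x) + (Y (n + k) x - Y n x)" by simp
    then have "norm (Y (n + Suc k) x - Y n x) \<le> norm (Y (Suc (n + k)) x - Y (n + k) x) + norm (Y (n + k) x - Y n x)"
      by (metis norm_triangle_ineq)
    then show ?case using Suc stepY[of "n + k" x] by (simp add: algebra_simps)
  qed simp
  have "incseq y" using ystep by (rule incseq_SucI)
  then have "convergent y" using y01 by (intro Bseq_mono_convergent)
      (auto simp: Bseq_def incseq_def intro!: exI[of _ 1])
  then have Cy: "Cauchy y" by (rule convergent_Cauchy)
  have "Cauchy (\<lambda>n. Y n x)" for x
  proof (rule CauchyI')
    fix e :: real
    assume "e > 0"
    then obtain M where M: "\<And>m n. m \<ge> M \<Longrightarrow> n \<ge> M \<Longrightarrow> norm (y m - y n) < e / (norm x + 1)"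
      using CauchyD[OF Cy, of "e / (norm x + 1)"] by (auto simp: add_nonneg_pos)
    have "dist (Y m x) (Y n x) < e" if "m \<ge> M" "m < n" for m n
    proof -
      have "dist (Y m x) (Y n x) \<le> (y n - y m) * norm x"
        using gapY[of m "n - m" x] that by (simp add: dist_norm norm_minus_commute)
      also have "\<dots> \<le> (e / (norm x + 1)) * norm x"
        using M[of n m] that by (intro mult_right_mono) auto
      also have "\<dots> < e" using \<open>e > 0\<close> by (simp add: field_simps add_pos_nonneg)
      finally show ?thesis .
    qed
    then show "\<exists>M. \<forall>m\<ge>M. \<forall>n>m. dist (Y m x) (Y n x) < e" by blast
  qed
  then have "\<exists>l. (\<lambda>n. Y n x) \<longlonglongrightarrow> l" for x
    by (simp add: Cauchy_convergent_iff convergent_def)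
  then obtain L where L: "\<And>x. (\<lambda>n. Y n x) \<longlonglongrightarrow> L x" by metis
  show ?thesis
  proof (intro exI[of _ L] conjI allI impI)
    show "sa L"
      unfolding sa_def
    proof (rule adjpairI)
      fix u v
      have "(\<lambda>n. ip (Y n u) v) \<longlonglongrightarrow> ip (L u) v" "(\<lambda>n. ip u (Y n v)) \<longlonglongrightarrow> ip u (L v)"
        by (intro ip.tendsto L tendsto_const)+
      then show "ip (L u) v = ip u (L v)"
        unfolding adjpairD[OF apY] by (rule LIMSEQ_unique)
    qed
    have le: "norm (Y n x) \<le> norm x" for n x
      using normY[of n x] y01[of n] by (smt (verit) mult_left_le_one_le norm_ge_zero)
    show "norm (L x) \<le> norm x" for x
      by (rule tendsto_upperbound[OF tendsto_norm[OF L]]) (auto simp: le)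
    show "X x = 2 *\<^sub>R L x - L (L x)" for x
    proof -
      have "(\<lambda>n. Y n (Y n x) - Y n (L x)) \<longlonglongrightarrow> 0"
      proof (rule Lim_null_comparison)
        show "\<forall>\<^sub>F n in sequentially. norm (Y n (Y n x) - Y n (L x)) \<le> norm (Y n x - L x)"
          using le by (simp flip: addY)
        show "(\<lambda>n. norm (Y n x - L x)) \<longlonglongrightarrow> 0"
          using L[of x] by (simp add: LIM_zero tendsto_norm_zero)
      qed
      from tendsto_add[OF this L[of "L x"]] have "(\<lambda>n. Y n (Y n x)) \<longlonglongrightarrow> L (L x)" by simp
      then have "(\<lambda>n. (1/2) *\<^sub>R (X x + Y n (Y n x))) \<longlonglongrightarrow> (1/2) *\<^sub>R (X x + L (L x))"
        by (intro tendsto_intros)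
      moreover have "(\<lambda>n. (1/2) *\<^sub>R (X x + Y n (Y n x))) \<longlonglongrightarrow> L x"
        using LIMSEQ_Suc[OF L[of x]] by (simp add: Y)
      ultimately have "(1/2) *\<^sub>R (X x + L (L x)) = L x" by (rule LIMSEQ_unique)
      then have "2 *\<^sub>R ((1/2) *\<^sub>R (X x + L (L x))) = 2 *\<^sub>R L x" by (rule arg_cong)
      then have "X x + L (L x) = 2 *\<^sub>R L x" unfolding scaleR_scaleR by simp
      then show ?thesis by (simp add: eq_diff_eq)
    qed
    fix C C' x
    assume C: "adjpair C C'" "\<forall>x. C (X x) = X (C x)"
    show "C (L x) = L (C x)"
    proof -
      interpret C: bounded_linear C using C(1) by (rule adjpair_bounded_linear)
      have "C (Y n x) = Y n (C x)" for n x
        by (induction n arbitrary: x) (simp_all add: Y C.zero C.scaleR C.add C(2))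
      then show ?thesis
        using LIMSEQ_unique[OF C.tendsto[OF L[of x]]] L[of "C x"] by simp
    qed
  qed
qed

text \<open>\<open>X = 1 - R / M\<close> is a contraction by the norm form of positivity, and
  \<open>sqrt M (1 - Y)\<close> squares to \<open>M (1 - X) = R\<close>. The last clause is what
  uniqueness and all transfers of commutation to absolute values draw on.\<close>

lemma pos_sqrt_exists:
  assumes R: "pos R"
  shows "\<exists>C. pos C \<and> (\<forall>x. C (C x) = R x) \<and>
    (\<forall>B B'. adjpair B B' \<longrightarrow> (\<forall>x. B (R x) = R (B x)) \<longrightarrow> (\<forall>x. B (C x) = C (B x)))"
proof -
  have ap: "adjpair R R" using R by (simp add: pos_def sa_def)
  obtain M where M: "M > 0" "\<And>x. norm (M *\<^sub>R x - R x) \<le> M * norm x"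
    using pos_obtain_bound[OF R] by blast
  define X where "X = (\<lambda>x. x - (1 / M) *\<^sub>R R x)"
  have X1: "norm (X x) \<le> norm x" for x
  proof -
    have "X x = (1 / M) *\<^sub>R (M *\<^sub>R x - R x)" using M(1) by (simp add: X_def algebra_simps)
    then have "norm (X x) = (1 / M) * norm (M *\<^sub>R x - R x)" using M(1) by simp
    then have "M * norm (X x) \<le> M * norm x" using M(1) M(2)[of x] by simp
    then show ?thesis using M(1) by simp
  qed
  have "sa X" unfolding sa_def X_def by (intro adjpair_intros ap)
  then obtain Y where Y: "sa Y" "\<And>x. norm (Y x) \<le> norm x" "\<And>x. X x = 2 *\<^sub>R Y x - Y (Y x)"
    "\<forall>C C'. adjpair C C' \<longrightarrow> (\<forall>x. C (X x) = X (C x)) \<longrightarrow> (\<forall>x. C (Y x) = Y (C x))"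
    using sqrt_of_contraction[OF _ X1] by blast
  have apY: "adjpair Y Y" using Y(1) by (simp add: sa_def)
  interpret Y: bounded_linear Y using apY by (rule adjpair_bounded_linear)
  define C where "C = (\<lambda>x. sqrt M *\<^sub>R (x - Y x))"
  have saC: "sa C" unfolding sa_def C_def by (intro adjpair_intros apY)
  show ?thesis
  proof (intro exI[of _ C] conjI allI impI)
    show "pos C"
    proof (rule pos_of_bound[OF saC, of "sqrt M"])
      show "norm (sqrt M *\<^sub>R x - C x) \<le> sqrt M * norm x" for x
        using Y(2)[of x] M(1) by (simp add: C_def scaleR_diff_right)
    qed (use M in simp)
    show "C (C x) = R x" for x
    proof -
      have "C (C x) = M *\<^sub>R (x - (2 *\<^sub>R Y x - Y (Y x)))"
        using M(1) by (simp add: C_def Y.scaleR Y.diff scaleR_2 algebra_simps)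
      also have "\<dots> = R x" using M(1) unfolding Y(3)[symmetric] by (simp add: X_def)
      finally show ?thesis .
    qed
    fix B B' x
    assume B: "adjpair B B'" "\<forall>x. B (R x) = R (B x)"
    show "B (C x) = C (B x)"
    proof -
      interpret B: bounded_linear B using B(1) by (rule adjpair_bounded_linear)
      have "\<forall>x. B (X x) = X (B x)" by (simp add: X_def B.diff B.scaleR B(2))
      then have "B (Y x) = Y (B x)" for x using Y(4) B(1) by blast
      then show ?thesis by (simp add: C_def B.scaleR B.diff)
    qed
  qed
qed

lemma pos_sqrt_exists_commuting:
  assumes "pos R" "adjpair D D'" "\<And>x. D (R x) = R (D x)"
  shows "\<exists>E. pos E \<and> (\<forall>x. E (E x) = R x) \<and> (\<forall>x. D (E x) = E (D x))"
  using pos_sqrt_exists[OF assms(1)] assms(2,3) by blast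

lemma sa_square_zero:
  assumes S: "sa S" and 0: "\<And>x. S (S x) = 0" shows "S x = 0"
proof -
  have "norm (S (S x)) \<le> 0\<^sup>2 * norm x" for x by (simp add: 0)
  from sa_bound_of_square[OF S _ this, of x] show ?thesis by simp
qed

text \<open>With \<open>D = R - C\<close>, commutation gives \<open>D (R + C) = 0\<close>, so
  \<open>R D D\<close> and \<open>C D D\<close> are positive with sum zero and vanish. They are the
  squares of the self-adjoint \<open>E D\<close> and \<open>F D\<close>, where \<open>E\<close>,
  \<open>F\<close> are roots of \<open>R\<close>, \<open>C\<close>. Hence \<open>E D\<close>,
  \<open>F D\<close>, then \<open>D D\<close>, then \<open>D\<close> vanish.\<close>

lemma pos_sqrt_unique_aux:
  assumes R: "pos R" and C: "pos C" and sq: "\<And>x. R (R x) = C (C x)" and com: "\<And>x. R (C x) = C (R x)"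
  shows "R = C"
proof -
  have apR: "adjpair R R" and apC: "adjpair C C" using R C by (auto simp: pos_def sa_def)
  interpret R: bounded_linear R using apR by (rule adjpair_bounded_linear)
  interpret C: bounded_linear C using apC by (rule adjpair_bounded_linear)
  define D where "D = (\<lambda>x. R x - C x)"
  have apD: "adjpair D D" unfolding D_def by (intro adjpair_intros apR apC)
  interpret D: bounded_linear D using apD by (rule adjpair_bounded_linear)
  have DR: "D (R x) = R (D x)" and DC: "D (C x) = C (D x)" for x
    by (simp_all add: D_def R.diff C.diff com)
  have sum0: "D (R x) + D (C x) = 0" for x by (simp add: D_def sq com)
  obtain E where E: "pos E" "\<And>x. E (E x) = R x" "\<And>x. D (E x) = E (D x)"
    using pos_sqrt_exists_commuting[OF R apD DR] by blast
  obtain F where F: "pos F" "\<And>x. F (F x) = C x" "\<And>x. D (F x) = F (D x)"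
    using pos_sqrt_exists_commuting[OF C apD DC] by blast
  have apE: "adjpair E E" and apF: "adjpair F F" using E(1) F(1) by (auto simp: pos_def sa_def)
  have saED: "sa (\<lambda>x. E (D x))" and saFD: "sa (\<lambda>x. F (D x))"
    using adjpair_comp[OF apE apD] adjpair_comp[OF apF apD] E(3) F(3) by (simp_all add: sa_def)
  have eqE: "E (D (E (D x))) = R (D (D x))" and eqF: "F (D (F (D x))) = C (D (D x))" for x
    by (simp_all add: E F)
  have neg: "C (D (D x)) = - R (D (D x))" for x
    using sum0[of "D x"] by (simp add: DR DC eq_neg_iff_add_eq_0 add.commute)
  have "pos (\<lambda>x. R (D (D x)))" "pos (\<lambda>x. - R (D (D x)))"
    using pos_square[OF saED] pos_square[OF saFD] by (simp_all add: eqE eqF neg)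
  then have RDD: "R (D (D x)) = 0" for x by (rule pos_antisym)
  have ED: "E (D x) = 0" for x by (rule sa_square_zero[OF saED]) (simp add: eqE RDD)
  have FD: "F (D x) = 0" for x by (rule sa_square_zero[OF saFD]) (simp add: eqF neg RDD)
  have zE: "E 0 = 0" and zF: "F 0 = 0"
    using linear_0[OF bounded_linear.linear[OF adjpair_bounded_linear]] apE apF by blast+
  have "D (D x) = 0" for x
  proof -
    have "D (D x) = R (D x) - C (D x)" by (simp add: D_def)
    also have "\<dots> = E (E (D x)) - F (F (D x))" by (simp add: E F)
    finally show ?thesis by (simp add: ED FD zE zF)
  qed
  then have "D x = 0" for x using sa_square_zero[of D x] apD by (simp add: sa_def)
  then show ?thesis by (auto simp: D_def)
qed

text \<open>\<open>R\<close> and \<open>Q\<close> are not known to commute with each other, but the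
  constructed root \<open>C\<close> commutes with whatever commutes with the common square, hence
  with both.\<close>

lemma pos_sqrt_unique:
  assumes R: "pos R" and Q: "pos Q" and sq: "\<And>x. R (R x) = Q (Q x)"
  shows "R = Q"
proof -
  have apR: "adjpair R R" and apQ: "adjpair Q Q" using R Q by (auto simp: pos_def sa_def)
  obtain C where C: "pos C" "\<And>x. C (C x) = R (R x)"
    "\<forall>B B'. adjpair B B' \<longrightarrow> (\<forall>x. B (R (R x)) = R (R (B x))) \<longrightarrow> (\<forall>x. B (C x) = C (B x))"
    using pos_sqrt_exists[OF pos_square[OF pos_sa[OF R]]] by blast
  have "R = C" by (rule pos_sqrt_unique_aux[OF R C(1)]) (use C(2) C(3) apR in auto)
  moreover have "Q = C" by (rule pos_sqrt_unique_aux[OF Q C(1)]) (use C(2) C(3) apQ sq in auto)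
  ultimately show ?thesis by simp
qed

section \<open>Agreement with the spectral definitions of positivity and square root\<close>

lemma op_positive_iff_pos: "op_positive ip R \<longleftrightarrow> pos R"
proof -
  have spectrum: "op_spectrum ip R = {c. \<not> invop (\<lambda>x. c *\<^sub>C x - R x)}"
    unfolding op_spectrum_def invop_def
    using adjpair_adjointable adjointable_adjpair by (auto simp: fun_eq_iff) blast+
  have saR: "R \<in> adjointable ip \<and> adj ip R = R \<longleftrightarrow> sa R"
    unfolding sa_def using adjointable_adjpair adjpair_adj adjpair_adjointable by metis
  have neg: "invop (\<lambda>x. - (c *\<^sub>R x) - R x) \<longleftrightarrow> invop (\<lambda>x. c *\<^sub>R x + R x)" for c
  proof
    assume "invop (\<lambda>x. - (c *\<^sub>R x) - R x)"
    from invop_comp[OF invop_scaleR[of "-1"] this] show "invop (\<lambda>x. c *\<^sub>R x + R x)"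
      by (simp add: add.commute)
  next
    assume "invop (\<lambda>x. c *\<^sub>R x + R x)"
    from invop_comp[OF invop_scaleR[of "-1"] this] show "invop (\<lambda>x. - (c *\<^sub>R x) - R x)" by simp
  qed
  have "{c. \<not> invop (\<lambda>x. c *\<^sub>C x - R x)} \<subseteq> \<real>\<^sub>\<ge>\<^sub>0 \<longleftrightarrow> (\<forall>s>0. invop (\<lambda>x. s *\<^sub>R x + R x))"
    if R: "sa R"
  proof
    assume L: "{c. \<not> invop (\<lambda>x. c *\<^sub>C x - R x)} \<subseteq> \<real>\<^sub>\<ge>\<^sub>0"
    show "\<forall>s>0. invop (\<lambda>x. s *\<^sub>R x + R x)"
    proof (intro allI impI)
      fix s :: real assume "s > 0"
      then have "of_real (- s) \<notin> (\<real>\<^sub>\<ge>\<^sub>0 :: complex set)" by (simp add: nonneg_Reals_of_real_iff del: of_real_minus)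
      then have "invop (\<lambda>x. of_real (- s) *\<^sub>C x - R x)" using L by blast
      then show "invop (\<lambda>x. s *\<^sub>R x + R x)" by (simp add: scaleC_of_real neg del: of_real_minus)
    qed
  next
    assume P: "\<forall>s>0. invop (\<lambda>x. s *\<^sub>R x + R x)"
    show "{c. \<not> invop (\<lambda>x. c *\<^sub>C x - R x)} \<subseteq> \<real>\<^sub>\<ge>\<^sub>0"
    proof
      fix c assume "c \<in> {c. \<not> invop (\<lambda>x. c *\<^sub>C x - R x)}"
      then have c: "\<not> invop (\<lambda>x. c *\<^sub>C x - R x)" by simp
      then have "Im c = 0" using sa_invop_nonreal[OF R] by blast
      then have cr: "c = of_real (- (- Re c))" by (simp add: complex_eq_iff)
      have "\<not> Re c < 0"
      proof
        assume "Re c < 0"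
        then have "invop (\<lambda>x. of_real (- (- Re c)) *\<^sub>C x - R x)"
          using spec[OF P, of "- Re c"] neg[of "- Re c"] unfolding scaleC_of_real by simp
        then show False using c cr by simp
      qed
      then show "c \<in> \<real>\<^sub>\<ge>\<^sub>0" using \<open>Im c = 0\<close> by (simp add: complex_nonneg_Reals_iff)
    qed
  qed
  then show ?thesis unfolding op_positive_def pos_def spectrum using saR by blast
qed

lemma op_sqrt_eqI:
  assumes "pos R" "\<And>x. R (R x) = S x" shows "op_sqrt ip S = R"
  unfolding op_sqrt_def op_positive_iff_pos
proof (rule the_equality)
  show "pos R \<and> R \<circ> R = S" using assms by auto
  show "Q = R" if "pos Q \<and> Q \<circ> Q = S" for Q
    using that assms by (intro pos_sqrt_unique) auto
qed

lemma op_sqrt_props: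
  assumes "pos S"
  shows pos_op_sqrt: "pos (op_sqrt ip S)"
    and op_sqrt_square: "op_sqrt ip S (op_sqrt ip S x) = S x"
    and op_sqrt_commute: "adjpair B B' \<Longrightarrow> (\<And>x. B (S x) = S (B x)) \<Longrightarrow> B (op_sqrt ip S x) = op_sqrt ip S (B x)"
proof -
  obtain C where C: "pos C" "\<And>x. C (C x) = S x"
    "\<forall>B B'. adjpair B B' \<longrightarrow> (\<forall>x. B (S x) = S (B x)) \<longrightarrow> (\<forall>x. B (C x) = C (B x))"
    using pos_sqrt_exists[OF assms] by blast
  have eq: "op_sqrt ip S = C" by (rule op_sqrt_eqI[OF C(1,2)])
  show "pos (op_sqrt ip S)" "op_sqrt ip S (op_sqrt ip S x) = S x"
    using C(1,2) by (simp_all add: eq)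
  show "B (op_sqrt ip S x) = op_sqrt ip S (B x)" if "adjpair B B'" "\<And>x. B (S x) = S (B x)"
    unfolding eq using C(3) that by blast
qed

end

section \<open>Hilbert modules\<close>

interpretation calg: cs_module "\<lambda>a b :: 'a::cstar_algebra. star a * b"
proof
  fix x y z :: 'a and c
  show "star x * (y + z) = star x * y + star x * z" by (simp add: distrib_left)
  show "star x * (c *\<^sub>C y) = c *\<^sub>C (star x * y)" by (rule mult_scaleC_right)
  show "star y * x = star (star x * y)" by (simp add: star_mult star_star)
  show "norm (star x * x) = (norm x)\<^sup>2" by (rule cstar_identity)
  show "norm (star x * y) \<le> norm x * norm y" using norm_mult_ineq[of "star x" y] by simp
qed

lemma calg_adjpair_mult: "calg.adjpair (\<lambda>y. a * y) (\<lambda>y. star a * y)"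
  by (rule calg.adjpairI) (simp add: star_mult mult.assoc)

text \<open>The unitization inverse \<open>(w1, w2)\<close> of \<open>(- s, - a)\<close> acts on the
  algebra by \<open>w1\<close> plus left multiplication by \<open>w2\<close>; the negative of this
  action inverts \<open>s + a\<close>.\<close>

lemma calg_pos_of_positive:
  assumes a: "cstar_positive a" shows "calg.pos (\<lambda>y. a * y)"
  unfolding calg.pos_def
proof (intro conjI allI impI)
  have "star a = a" using a by (simp add: cstar_positive_def)
  then show "calg.sa (\<lambda>y. a * y)" using calg_adjpair_mult[of a] by (simp add: calg.sa_def)
  fix s :: real
  assume "s > 0"
  then have "of_real (- s) \<notin> (\<real>\<^sub>\<ge>\<^sub>0 :: complex set)"
    by (simp add: nonneg_Reals_of_real_iff del: of_real_minus)
  then have "of_real (- s) \<notin> cstar_spectrum a" using a by (auto simp: cstar_positive_def)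
  then obtain w1 w2 where
    r: "unitization_mult (of_real (- s), - a) (w1, w2) = (1, 0)" and
    l: "unitization_mult (w1, w2) (of_real (- s), - a) = (1, 0)"
    unfolding cstar_spectrum_def by auto
  have w1: "of_real s * w1 = -1" "w1 * of_real s = -1"
    using r by (auto simp: unitization_mult_def minus_equation_iff[of _ 1])
  have R: "s *\<^sub>R w2 + w1 *\<^sub>C a + a * w2 = 0" and L: "s *\<^sub>R w2 + w1 *\<^sub>C a + w2 * a = 0"
    using r l by (simp_all add: unitization_mult_def scaleC_linear scaleC_of_real
        neg_eq_iff_add_eq_0 del: of_real_minus add: algebra_simps)
  define Q where "Q = (\<lambda>y. - (w1 *\<^sub>C y + w2 * y))"
  have "calg.adjpair Q (\<lambda>y. - (cnj w1 *\<^sub>C y + star w2 * y))"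
    unfolding Q_def by (intro calg.adjpair_intros calg_adjpair_mult)
  moreover have "s *\<^sub>R Q y + a * Q y = y" for y
  proof -
    have "s *\<^sub>R Q y + a * Q y = - ((of_real s * w1) *\<^sub>C y) - (s *\<^sub>R w2 + w1 *\<^sub>C a + a * w2) * y"
      by (simp add: Q_def distrib_left distrib_right scaleR_scaleC mult_scaleC_left mult_scaleC_right
          mult.assoc right_diff_distrib scaleR_diff_right scaleR_add_right)
    then show ?thesis unfolding R w1 by (simp add: scaleC_minus_left)
  qed
  moreover have "Q (s *\<^sub>R y + a * y) = y" for y
  proof -
    have "Q (s *\<^sub>R y + a * y) = - ((w1 * of_real s) *\<^sub>C y) - (s *\<^sub>R w2 + w1 *\<^sub>C a + w2 * a) * y"
      by (simp add: Q_def distrib_left distrib_right scaleC_scaleR mult_scaleC_left mult_scaleC_right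
          mult.assoc right_diff_distrib scaleC_diff_right scaleC_add_right)
    then show ?thesis unfolding L w1 by (simp add: scaleC_minus_left)
  qed
  ultimately show "calg.invop (\<lambda>x. s *\<^sub>R x + a * x)" unfolding calg.invop_def by blast
qed

text \<open>The operator estimate is evaluated at \<open>star u\<close>, where the C*-identity gives
  \<open>norm (u * star u) = norm u * norm u\<close>.\<close>

lemma calg_norm_mono:
  assumes "calg.pos (\<lambda>y. u * y)" "calg.pos (\<lambda>y. v * y)"
  shows "norm u \<le> norm (u + v)"
proof (cases "u = 0")
  case False
  have "norm (u * star u) \<le> norm (u + v) * norm (star u)"
    by (rule calg.pos_norm_mono[OF assms]) (simp_all add: norm_mult_ineq flip: distrib_right)
  then have "norm u * norm u \<le> norm (u + v) * norm u"
    using cstar_identity[of "star u"] by (simp add: star_star power2_eq_square)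
  then show ?thesis using False by simp
qed simp

lemma calg_pos_square: "star h = h \<Longrightarrow> calg.pos (\<lambda>y. h * h * y)"
  using calg.pos_square[of "\<lambda>y. h * y"] calg_adjpair_mult[of h]
  by (simp add: calg.sa_def mult.assoc)

locale positive_cs_module = cs_module ip
  for ip :: "'h::complex_banach \<Rightarrow> 'h \<Rightarrow> 'a::cstar_algebra" +
  assumes ip_pos: "calg.pos (\<lambda>a. ip x x * a)"

text \<open>
  Only squares of self-adjoint elements need to be positive here; the general case is reduced to
  this one by replacing \<open>y\<close> with \<open>act y (star (ip x y))\<close>.
\<close>

lemma hilbert_Cauchy_Schwarz_aux:
  assumes H: "hilbert_cstar_module act ip" and x: "norm x = 1" and h: "star (ip x y) = ip x y"
  shows "norm (ip x y) \<le> norm y"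
proof -
  interpret hilbert_cstar_module act ip by (rule H)
  have nrm: "norm (ip z z) = (norm z)\<^sup>2" for z by (simp add: norm_eq_sqrt_ip)
  have add_left: "ip (u + v) w = ip u w + ip v w" for u v w
    by (metis ip_add_right ip_star star_add)
  have diff_right: "ip w (u - v) = ip w u - ip w v" for u v w
    using ip_add_right[of w "u - v" v] by (simp add: eq_diff_eq)
  have diff_left: "ip (u - v) w = ip u w - ip v w" for u v w
    using add_left[of "u - v" v w] by (simp add: eq_diff_eq)
  define h where "h = ip x y"
  have sh: "star h = h" "ip y x = h" using h ip_star[of y x] by (simp_all add: h_def)
  have act_left: "ip (act u a) v = star a * ip u v" for u a v
    by (metis ip_act_right ip_star star_mult)
  \<comment> \<open>Expanding \<open>ip z z\<close> and moving \<open>h * ip x x * h\<close> to the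
    side where only its norm matters avoids comparing it with \<open>h * h\<close> as elements. The
    result is \<open>2 (norm h)^2 \<le> (norm h)^2 + (norm y)^2\<close>.\<close>
  define z where "z = act x h - y"
  have "ip z z = h * ip x x * h - (h * h + h * h) + ip y y"
    by (simp add: z_def diff_left diff_right act_left ip_act_right sh left_diff_distrib mult.assoc flip: h_def)
  then have eq: "(h * h + h * h) + ip z z = h * ip x x * h + ip y y" by simp
  have "calg.pos (\<lambda>a. (h * h + h * h) * a)"
    using calg.pos_add[OF calg_pos_square[OF sh(1)] calg_pos_square[OF sh(1)]]
    by (simp add: distrib_right)
  then have "norm (h * h + h * h) \<le> norm (h * ip x x * h + ip y y)"
    using calg_norm_mono[OF _ calg_pos_of_positive[OF ip_positive[of z]]] by (simp flip: eq)
  also have "\<dots> \<le> norm (h * ip x x * h) + norm (ip y y)" by (rule norm_triangle_ineq)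
  also have "norm (h * ip x x * h) \<le> norm h * norm h"
    using norm_mult_ineq[of "h * ip x x" h] norm_mult_ineq[of h "ip x x"] x nrm[of x]
    by (smt (verit) mult_cancel_left1 mult_right_mono norm_ge_zero one_power2)
  finally have "norm (h * h + h * h) \<le> norm h * norm h + (norm y)\<^sup>2" by (simp add: nrm)
  moreover have "norm (h * h + h * h) = 2 * (norm h * norm h)"
    using cstar_identity[of h] sh(1) by (simp add: power2_eq_square flip: scaleR_2)
  ultimately have "(norm h)\<^sup>2 \<le> (norm y)\<^sup>2" by (simp add: power2_eq_square)
  then show ?thesis unfolding h_def by (rule power2_le_imp_le) simp
qed

lemma hilbert_positive_cs_module:
  assumes H: "hilbert_cstar_module act ip" shows "positive_cs_module ip"
proof -
  interpret hilbert_cstar_module act ip by (rule H)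
  have nrm: "norm (ip z z) = (norm z)\<^sup>2" for z by (simp add: norm_eq_sqrt_ip)
  have scale_left: "ip (r *\<^sub>R u) v = r *\<^sub>R ip u v" for r u v
    by (metis ip_scaleC_right ip_star scaleC_of_real star_scaleR)
  have CSh: "norm (ip x y) \<le> norm x * norm y" if h: "star (ip x y) = ip x y" for x y
  proof (cases "x = 0")
    case True
    then have "ip x y = 0" using scale_left[of 0 0 y] by simp
    then show ?thesis by simp
  next
    case False
    have "norm (ip ((1 / norm x) *\<^sub>R x) y) \<le> norm y"
      using False h by (intro hilbert_Cauchy_Schwarz_aux[OF H]) (simp_all add: scale_left star_scaleR)
    then show ?thesis using False by (simp add: scale_left field_simps)
  qed
  have CS: "norm (ip x y) \<le> norm x * norm y" for x y
  proof (cases "ip x y = 0")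
    case False
    define a where "a = ip x y"
    have ia: "ip x (act y (star a)) = a * star a" by (simp add: ip_act_right a_def)
    have "(norm a)\<^sup>2 = norm (a * star a)" using cstar_identity[of "star a"] by (simp add: star_star)
    also have "\<dots> \<le> norm x * norm (act y (star a))"
      using CSh[of x "act y (star a)"] unfolding ia by (simp add: star_mult star_star)
    finally have "(norm a)\<^sup>2 \<le> norm x * norm (act y (star a))" .
    moreover have "norm (act y (star a)) \<le> norm a * norm y"
    proof (rule power2_le_imp_le)
      have "(norm (act y (star a)))\<^sup>2 = norm (a * ip y y * star a)"
        by (metis ip_act_right ip_star mult.assoc nrm star_mult star_star)
      also have "\<dots> \<le> (norm a * (norm y)\<^sup>2) * norm a"
        using norm_mult_ineq[of "a * ip y y" "star a"] norm_mult_ineq[of a "ip y y"]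
        by (smt (verit) mult_right_mono norm_ge_zero norm_star nrm)
      finally show "(norm (act y (star a)))\<^sup>2 \<le> (norm a * norm y)\<^sup>2"
        by (simp add: power2_eq_square algebra_simps)
    qed simp
    ultimately have "(norm a)\<^sup>2 \<le> norm x * (norm a * norm y)"
      by (meson mult_left_mono norm_ge_zero order.trans)
    then have "norm a * norm a \<le> (norm x * norm y) * norm a"
      by (simp add: power2_eq_square algebra_simps)
    then show ?thesis using False by (simp add: a_def)
  qed simp
  show ?thesis
  proof
    show "calg.pos (\<lambda>a. ip x x * a)" for x by (rule calg_pos_of_positive[OF ip_positive])
  qed (rule ip_add_right ip_scaleC_right ip_star nrm CS)+
qed

section \<open>Positive products and absolute values in Hilbert modules\<close>

context positive_cs_module
begin

text \<open>Pairing \<open>(s + S' S) x\<close> with \<open>x\<close> gives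
  \<open>s (ip x x) + ip (S x) (S x)\<close>, whose norm is at least that of its first summand.
  Cauchy-Schwarz turns this into the lower bound \<open>s\<close>.\<close>

lemma pos_adj_comp:
  assumes S: "adjpair S S'" shows "pos (\<lambda>x. S' (S x))"
  unfolding pos_def
proof (intro conjI allI impI)
  have ap: "adjpair (\<lambda>x. S' (S x)) (\<lambda>x. S' (S x))" by (rule adjpair_comp[OF adjpair_sym[OF S] S])
  then show "sa (\<lambda>x. S' (S x))" by (simp add: sa_def)
  fix s :: real
  assume s: "s > 0"
  show "invop (\<lambda>x. s *\<^sub>R x + S' (S x))"
  proof (rule sa_invop_of_lower_bound[OF _ s])
    show "sa (\<lambda>x. s *\<^sub>R x + S' (S x))" unfolding sa_def by (intro adjpair_intros ap)
    fix x
    show "s * norm x \<le> norm (s *\<^sub>R x + S' (S x))"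
    proof (cases "x = 0")
      case False
      have "ip (sqrt s *\<^sub>R x) (sqrt s *\<^sub>R x) = s *\<^sub>R ip x x"
        using s by (simp add: ip.scaleR_left ip.scaleR_right)
      then have "norm (s *\<^sub>R ip x x) \<le> norm (s *\<^sub>R ip x x + ip (S x) (S x))"
        using calg_norm_mono[OF ip_pos[of "sqrt s *\<^sub>R x"] ip_pos[of "S x"]] by simp
      also have "s *\<^sub>R ip x x + ip (S x) (S x) = ip x (s *\<^sub>R x + S' (S x))"
        using S by (simp add: adjpairD ip_add_right ip.scaleR_right)
      also have "norm \<dots> \<le> norm x * norm (s *\<^sub>R x + S' (S x))" by (rule Cauchy_Schwarz)
      finally have "norm x * (s * norm x) \<le> norm x * norm (s *\<^sub>R x + S' (S x))"
        using s by (simp add: norm_ip_self power2_eq_square algebra_simps)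
      then show ?thesis using False by simp
    qed simp
  qed
qed

lemma pos_conj:
  assumes R: "pos R" and S: "adjpair S S'" shows "pos (\<lambda>x. S (R (S' x)))"
proof -
  obtain C where C: "pos C" "\<And>x. C (C x) = R x" using pos_sqrt_exists[OF R] by blast
  have "adjpair C C" using C(1) by (simp add: pos_def sa_def)
  then have "adjpair (\<lambda>x. C (S' x)) (\<lambda>x. S (C x))" using adjpair_comp adjpair_sym[OF S] by blast
  from pos_adj_comp[OF this] show ?thesis by (simp add: C(2))
qed

text \<open>The root \<open>C\<close> of \<open>R\<close> commutes with \<open>Q\<close>, so
  \<open>R Q\<close> is the conjugate \<open>C Q C\<close>.\<close>

lemma pos_mult:
  assumes R: "pos R" and Q: "pos Q" and com: "\<And>x. R (Q x) = Q (R x)"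
  shows "pos (\<lambda>x. R (Q x))"
proof -
  have apQ: "adjpair Q Q" using Q by (simp add: pos_def sa_def)
  then obtain C where C: "pos C" "\<And>x. C (C x) = R x" "\<And>x. Q (C x) = C (Q x)"
    using pos_sqrt_exists[OF R] com by metis
  have "adjpair C C" using C(1) by (simp add: pos_def sa_def)
  from pos_conj[OF Q this] show ?thesis by (simp add: C)
qed

lemma op_abs_adjpair:
  assumes "adjpair S S'"
  shows pos_op_abs: "pos (op_abs ip S)"
    and op_abs_square: "op_abs ip S (op_abs ip S x) = S' (S x)"
    and op_abs_commute: "adjpair B B' \<Longrightarrow> (\<And>x. B (S' (S x)) = S' (S (B x))) \<Longrightarrow>
       B (op_abs ip S x) = op_abs ip S (B x)"
  using op_sqrt_props[OF pos_adj_comp[OF assms]]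
  by (simp_all add: op_abs_def adjpair_adj[OF assms] comp_def)

lemma op_abs_eqI:
  assumes "adjpair S S'" "pos R" "\<And>x. R (R x) = S' (S x)" shows "op_abs ip S = R"
  using op_sqrt_eqI[OF assms(2), of "\<lambda>x. S' (S x)"] assms
  by (simp add: op_abs_def adjpair_adj[OF assms(1)] comp_def)

end

section \<open>Polar decomposition\<close>

definition comm :: "('h \<Rightarrow> 'h) \<Rightarrow> ('h \<Rightarrow> 'h) \<Rightarrow> bool" where
  "comm A B \<longleftrightarrow> (\<forall>x. A (B x) = B (A x))"

lemma commD: "comm A B \<Longrightarrow> A (B x) = B (A x)"
  by (simp add: comm_def)

lemma comm_sym: "comm A B \<Longrightarrow> comm B A"
  by (simp add: comm_def)

lemma commutator_eq_zero_iff: "commutator A B = (\<lambda>_. 0) \<longleftrightarrow> comm A B"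
  by (simp add: commutator_def comm_def fun_eq_iff)

context positive_cs_module
begin

lemma op_abs_comm:
  assumes S: "adjpair S S'" and B: "adjpair B B'" "comm B (\<lambda>x. S' (S x))"
  shows "comm B (op_abs ip S)"
  unfolding comm_def using op_abs_commute[OF S B(1)] B(2) by (simp add: comm_def)

lemma op_abs_adjpair_self: "adjpair S S' \<Longrightarrow> adjpair (op_abs ip S) (op_abs ip S)"
  using pos_op_abs pos_sa by (simp add: sa_def)

end

text \<open>
  A self-dual substitute for the polar decomposition \<open>T = U a\<close>, with \<open>V = U\<^sup>*\<close> and \<open>a = |T|\<close>. Below,
  \<open>b = |T\<^sup>*|\<close>, \<open>A n = |T\<^sup>n|\<close>, \<open>B n = |(T\<^sup>n)\<^sup>*|\<close>, \<open>am m = U\<^sup>m |T| (U\<^sup>m)\<^sup>*\<close> and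
  \<open>cm m = (U\<^sup>m)\<^sup>* |T\<^sup>*| U\<^sup>m\<close>.
\<close>

locale polar_data = positive_cs_module ip
  for ip :: "'h::complex_banach \<Rightarrow> 'h \<Rightarrow> 'a::cstar_algebra" +
  fixes U V a :: "'h \<Rightarrow> 'h"
  assumes UV: "adjpair U V"
    and pos_a: "pos a"
    and UVU: "U (V (U x)) = U x"
    and aVU: "a (V (U x)) = a x"
    and kernel: "a x = 0 \<Longrightarrow> U x = 0"
begin

lemma VU: "adjpair V U" using UV by (rule adjpair_sym)

lemma apa: "adjpair a a" using pos_a by (simp add: pos_def sa_def)

lemma VUV: "V (U (V x)) = V x"
proof -
  have "adjpair (\<lambda>x. U (V (U x))) (\<lambda>x. V (U (V x)))"
    by (rule adjpair_comp[OF UV adjpair_comp[OF VU UV]])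
  then have "(\<lambda>x. V (U (V x))) = V"
    using adjpair_unique UV by (simp add: UVU)
  then show ?thesis by metis
qed

lemma VUa: "V (U (a x)) = a x"
proof -
  have "adjpair (\<lambda>x. a (V (U x))) (\<lambda>x. V (U (a x)))"
    by (rule adjpair_comp[OF apa adjpair_comp[OF VU UV]])
  then have "(\<lambda>x. V (U (a x))) = a"
    using adjpair_unique apa by (simp add: aVU)
  then show ?thesis by metis
qed

definition b where "b = (\<lambda>x. U (a (V x)))"

definition T where "T = (\<lambda>x. U (a x))"

definition T' where "T' = (\<lambda>x. a (V x))"

text \<open>The new kernel condition comes from \<open>V (b x) = a (V x)\<close>: if
  \<open>b x\<close> is zero, the old kernel condition kills \<open>U (V x)\<close>, hence
  \<open>V x\<close>.\<close>

lemma dual: "polar_data ip V U b"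
proof
  show "adjpair V U" by (rule VU)
  show "pos b" unfolding b_def by (rule pos_conj[OF pos_a UV])
  show "V (U (V x)) = V x" for x by (rule VUV)
  show "b (U (V x)) = b x" for x by (simp add: b_def VUV)
  show "V x = 0" if "b x = 0" for x
  proof -
    have "a (V x) = V (b x)" by (simp add: b_def VUa)
    also have "\<dots> = 0"
      using that linear_0[OF bounded_linear.linear[OF adjpair_bounded_linear[OF VU]]] by simp
    finally have "U (V x) = 0" by (rule kernel)
    then have "V (U (V x)) = 0"
      using linear_0[OF bounded_linear.linear[OF adjpair_bounded_linear[OF VU]]] by simp
    then show ?thesis by (simp add: VUV)
  qed
qed

lemma dual_b: "polar_data.b V U b = a"
  unfolding polar_data.b_def[OF dual] by (simp add: b_def VUa aVU)

lemma dual_T: "polar_data.T V b = T'"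
  unfolding polar_data.T_def[OF dual] by (simp add: T'_def b_def VUa)

lemma dual_T': "polar_data.T' U b = T"
  unfolding polar_data.T'_def[OF dual] by (simp add: T_def b_def aVU)

lemma TT': "adjpair T T'"
  unfolding T_def T'_def by (rule adjpair_comp[OF UV apa])

lemma apb: "adjpair b b"
  by (rule polar_data.apa[OF dual])

lemma kernel_eq: "a x = a y \<Longrightarrow> U x = U y"
  using kernel[of "x - y"] linear_diff[OF bounded_linear.linear[OF adjpair_bounded_linear[OF apa]]]
    linear_diff[OF bounded_linear.linear[OF adjpair_bounded_linear[OF UV]]] by simp

text \<open>Let \<open>p = V U\<close>. From \<open>a X = a X p\<close>, \<open>kernel_eq\<close>
  gives \<open>U X = U X p\<close>, so \<open>p X = p X p\<close> is self-adjoint and equals its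
  adjoint \<open>X p\<close>.\<close>

lemma comm_VU:
  assumes X: "adjpair X X" "comm X a" shows "X (V (U x)) = V (U (X x))"
proof -
  have "a (X x) = a (X (V (U x)))" for x
    using commD[OF X(2), of x] commD[OF X(2), of "V (U x)"] by (simp add: aVU)
  then have *: "U (X (V (U x))) = U (X x)" for x by (metis kernel_eq)
  have p: "adjpair (\<lambda>x. V (U x)) (\<lambda>x. V (U x))" by (rule adjpair_comp[OF VU UV])
  have "adjpair (\<lambda>x. V (U (X x))) (\<lambda>x. X (V (U x)))" by (rule adjpair_comp[OF p X(1)])
  moreover have "adjpair (\<lambda>x. V (U (X (V (U x))))) (\<lambda>x. V (U (X (V (U x)))))"
    by (rule adjpair_comp[OF p adjpair_comp[OF X(1) p]])
  ultimately have "(\<lambda>x. X (V (U x))) = (\<lambda>x. V (U (X x)))"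
    unfolding * by (rule adjpair_unique)
  then show ?thesis by metis
qed

lemma comm_UV:
  assumes "adjpair X X" "comm X b" shows "X (U (V x)) = U (V (X x))"
  by (rule polar_data.comm_VU[OF dual assms])

section \<open>Absolute values of powers and transport of commutation\<close>

definition A where "A n = op_abs ip (T ^^ n)"

definition B where "B n = op_abs ip (T' ^^ n)"

lemma dual_A: "polar_data.A ip V b = B"
  by (auto simp: polar_data.A_def[OF dual] B_def dual_T)

lemma dual_B: "polar_data.B ip U b = A"
  by (auto simp: polar_data.B_def[OF dual] A_def dual_T')

lemma pow_adj: "adjpair (T ^^ n) (T' ^^ n)"
  by (rule adjpair_funpow[OF TT'])

lemma pos_A: "pos (A n)"
  unfolding A_def by (rule pos_op_abs[OF pow_adj])

lemma apA: "adjpair (A n) (A n)"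
  using pos_A by (simp add: pos_def sa_def)

lemma A_square: "A n (A n x) = (T' ^^ n) ((T ^^ n) x)"
  unfolding A_def by (rule op_abs_square[OF pow_adj])

lemma A_1: "A 1 = a"
  unfolding A_def
  by (rule op_abs_eqI[OF pow_adj pos_a]) (simp add: T_def T'_def VUa)

lemma apB: "adjpair (B n) (B n)"
  using polar_data.apA[OF dual] by (simp add: dual_A)

lemma B_square: "B n (B n x) = (T ^^ n) ((T' ^^ n) x)"
  using polar_data.A_square[OF dual] by (simp add: dual_A dual_T dual_T')

lemma B_1: "B 1 = b"
  using polar_data.A_1[OF dual] by (simp add: dual_A)

text \<open>Combines the intertwining relations \<open>a V = V b\<close> and
  \<open>b U = U a\<close>.\<close>

lemma comm_a_conj:
  assumes "comm Z b" shows "comm a (\<lambda>x. V (Z (U x)))"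
  unfolding comm_def
proof
  fix x
  have "a (V (Z (U x))) = V (b (Z (U x)))" by (simp add: b_def VUa)
  also have "\<dots> = V (Z (b (U x)))" using assms by (simp add: comm_def)
  also have "\<dots> = V (Z (U (a x)))" by (simp add: b_def aVU)
  finally show "a (V (Z (U x))) = V (Z (U (a x)))" .
qed

text \<open>\<open>W = V (A k) U\<close> commutes with \<open>a\<close>, so \<open>a W\<close> is
  positive. Since \<open>A k\<close> commutes with \<open>U V\<close>, the square of
  \<open>W\<close> is \<open>V (A k) (A k) U\<close>, and \<open>a W W a\<close> is the required
  product of powers.\<close>

lemma A_Suc:
  assumes c: "comm (A k) b" shows "A (Suc k) = (\<lambda>x. a (V (A k (U x))))"
  unfolding A_def[of "Suc k"]
proof (rule op_abs_eqI[OF pow_adj])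
  define W where "W = (\<lambda>x. V (A k (U x)))"
  have aW: "a (W x) = W (a x)" for x using comm_a_conj[OF c] by (simp add: W_def comm_def)
  have "pos W" unfolding W_def by (rule pos_conj[OF pos_A VU])
  from pos_mult[OF pos_a this aW] have "pos (\<lambda>x. a (W x))" .
  then show "pos (\<lambda>x. a (V (A k (U x))))" by (simp add: W_def)
  fix x
  have "W (W y) = V (A k (A k (U y)))" for y
    by (simp add: W_def comm_UV[OF apA c] VUV)
  then have "a (W (a (W x))) = a (V ((T' ^^ k) ((T ^^ k) (U (a x)))))"
    by (simp add: aW A_square)
  moreover have "(T' ^^ Suc k) ((T ^^ Suc k) x) = a (V ((T' ^^ k) ((T ^^ k) (U (a x)))))"
  proof -
    have "(T ^^ Suc k) x = (T ^^ k) (T x)" by (simp add: funpow_swap1)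
    moreover have "T x = U (a x)" by (simp add: T_def)
    moreover have "(T' ^^ Suc k) z = a (V ((T' ^^ k) z))" for z by (simp add: T'_def)
    ultimately show ?thesis by metis
  qed
  ultimately show "a (V (A k (U (a (V (A k (U x))))))) = (T' ^^ Suc k) ((T ^^ Suc k) x)"
    by (simp add: W_def)
qed

text \<open>Inserting the projection \<open>V U\<close>, which commutes with \<open>X\<close>,
  exposes the factor \<open>U X V\<close> to which the assumption applies.\<close>

lemma comm_conj:
  assumes X: "adjpair X X" "comm X a" and c: "comm (\<lambda>x. U (X (V x))) Z"
  shows "comm X (\<lambda>x. V (Z (U x)))"
  unfolding comm_def
proof
  fix x
  have "X (V (Z (U x))) = V (U (X (V (Z (U x)))))"
    using comm_VU[OF X, of "V (Z (U x))"] by (simp add: VUV)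
  also have "\<dots> = V (Z (U (X (V (U x)))))" using c by (simp add: comm_def)
  also have "\<dots> = V (Z (U (X x)))" by (simp add: comm_VU[OF X] UVU)
  finally show "X (V (Z (U x))) = V (Z (U (X x)))" .
qed

lemma comm_A_Suc_iff:
  assumes X: "adjpair X X" "comm X a" and c: "comm (A k) b"
  shows "comm X (A (Suc k)) \<longleftrightarrow> comm (\<lambda>x. U (X (V x))) (A k)"
proof
  assume "comm (\<lambda>x. U (X (V x))) (A k)"
  from comm_conj[OF X this] show "comm X (A (Suc k))"
    using X(2) by (simp add: A_Suc[OF c] comm_def)
next
  assume L: "comm X (A (Suc k))"
  \<comment> \<open>The left factor \<open>a\<close> of \<open>A (Suc k)\<close> is exchanged for
    \<open>U\<close>. The trailing \<open>U\<close> is then removed by inserting \<open>V\<close> on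
    the right, as \<open>U V\<close> commutes with \<open>A k\<close>.\<close>
  have *: "U (X (V (A k (U x)))) = U (V (A k (U (X x))))" for x
  proof (rule kernel_eq)
    show "a (X (V (A k (U x)))) = a (V (A k (U (X x))))"
      using L X(2) by (simp add: A_Suc[OF c] comm_def)
  qed
  show "comm (\<lambda>x. U (X (V x))) (A k)"
    unfolding comm_def
  proof
    fix x
    have "U (X (V (A k x))) = U (X (V (A k (U (V x)))))"
      by (simp add: comm_UV[OF apA c] VUV)
    also have "\<dots> = A k (U (X (V x)))"
      unfolding * by (simp add: UVU flip: comm_UV[OF apA c])
    finally show "U (X (V (A k x))) = A k (U (X (V x)))" .
  qed
qed

definition am where "am m = (\<lambda>x. (U ^^ m) (a ((V ^^ m) x)))"

definition cm where "cm m = (\<lambda>x. (V ^^ m) (b ((U ^^ m) x)))"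

lemma dual_am: "polar_data.am V U b = cm"
  by (auto simp: polar_data.am_def[OF dual] cm_def)

lemma am_0: "am 0 = a" by (simp add: am_def)

lemma am_1: "am 1 = b" by (simp add: am_def b_def)

lemma am_Suc: "am (Suc m) = (\<lambda>x. U (am m (V x)))"
  by (simp add: am_def funpow_swap1)

lemma apam: "adjpair (am m) (am m)"
  unfolding am_def
  by (rule adjpair_comp[OF adjpair_funpow[OF UV] adjpair_comp[OF apa adjpair_funpow[OF VU]]])

text \<open>
  All commutation relations between \<open>am m\<close> and \<open>A k\<close> on one diagonal \<open>m + k = n + 1\<close> are equivalent,
  given those on the smaller diagonals.
\<close>

lemma comm_am_A_of_restricted:
  assumes t: "\<And>n. n \<ge> 1 \<Longrightarrow> t n \<in> {1..n} \<and> comm (am (t n)) (A (n + 1 - t n))"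
  shows "m \<ge> 1 \<Longrightarrow> k \<ge> 1 \<Longrightarrow> comm (am m) (A k)"
proof (induction "m + k" arbitrary: m k rule: less_induct)
  case less
  define n where "n = m + k - 1"
  have n: "n \<ge> 1" "m + k = n + 1" using less.prems by (auto simp: n_def)
  have step: "comm (am (Suc j)) (A (n + 1 - Suc j)) \<longleftrightarrow> comm (am j) (A (n + 1 - j))"
    if j: "1 \<le> j" "j < n" for j
  proof -
    \<comment> \<open>The side conditions of \<open>comm_A_Suc_iff\<close> lie on the diagonals
      \<open>j + 1\<close> and \<open>n - j + 1\<close>, both below \<open>n + 1\<close>.\<close>
    have "comm (am j) (A 1)" "comm (am 1) (A (n - j))"
      using j n by (auto intro!: less.hyps)
    then have "comm (am j) (A (Suc (n - j))) \<longleftrightarrow> comm (\<lambda>x. U (am j (V x))) (A (n - j))"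
      unfolding A_1 am_1 by (intro comm_A_Suc_iff apam comm_sym[of b])
    then show ?thesis using j by (simp add: am_Suc Suc_diff_le)
  qed
  have first: "comm (am j) (A (n + 1 - j)) \<longleftrightarrow> comm (am 1) (A (n + 1 - 1))" if "1 \<le> j" "j \<le> n" for j
    using that
  proof (induction j rule: dec_induct)
    case (step j)
    then show ?case using \<open>\<And>j. 1 \<le> j \<Longrightarrow> j < n \<Longrightarrow> _\<close>[of j] by simp
  qed simp
  have "comm (am (t n)) (A (n + 1 - t n))" "1 \<le> t n" "t n \<le> n" using t[OF n(1)] by auto
  then have "comm (am m) (A (n + 1 - m))" using first[of m] first[of "t n"] less.prems n by auto
  moreover have "n + 1 - m = k" using n by linarith
  ultimately show ?case by simp
qed

text \<open>\<open>comm_conj\<close> lowers the index of \<open>cm\<close> at the price of raising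
  that of \<open>am\<close>; the descent ends at \<open>cm 1 = a\<close>.\<close>

lemma comm_am_cm:
  assumes v: "\<And>n. n \<ge> 1 \<Longrightarrow> comm (am n) a"
  shows "m \<ge> 1 \<Longrightarrow> comm (am m) (cm (Suc k))"
proof (induction k arbitrary: m)
  case 0
  have "cm (Suc 0) = a" by (simp add: cm_def b_def VUa aVU)
  then show ?case using v 0 by simp
next
  case (Suc k)
  have "cm (Suc (Suc k)) = (\<lambda>x. V (cm (Suc k) (U x)))" by (simp add: cm_def funpow_swap1)
  moreover have "comm (\<lambda>x. U (am m (V x))) (cm (Suc k))" using Suc.IH[of "Suc m"] by (simp add: am_Suc)
  ultimately show ?case using comm_conj[OF apam v] Suc.prems by simp
qed

text \<open>\<open>V U\<close> commutes with each \<open>am j\<close> and is absorbed by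
  \<open>U\<close>, so conjugation by \<open>U\<close> is multiplicative on these operators and both
  indices drop together.\<close>

lemma comm_am_am:
  assumes v: "\<And>n. n \<ge> 1 \<Longrightarrow> comm (am n) a"
  shows "comm (am m) (am n)"
proof (induction m arbitrary: n)
  case 0
  show ?case unfolding am_0 using v[of n] by (cases n) (auto simp: am_0 comm_def)
next
  case (Suc m)
  show ?case
  proof (cases n)
    case 0
    then show ?thesis using v[of "Suc m"] by (simp add: am_0)
  next
    case (Suc k)
    have a': "comm (am j) a" for j using v[of j] by (cases j) (auto simp: am_0 comm_def)
    have "U (am i (V (U (am j x)))) = U (am i (am j x))" for i j x
      by (simp add: comm_VU[OF apam a'] UVU)
    then show ?thesis using Suc.IH[of k] unfolding \<open>n = Suc k\<close> by (simp add: am_Suc comm_def)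
  qed
qed

text \<open>By \<open>A_Suc\<close> each operator is \<open>a\<close> times a conjugate
  \<open>V A U\<close> commuting with \<open>a\<close>. Such conjugates multiply like the
  \<open>A\<close> themselves, since \<open>U V\<close> commutes with these.\<close>

lemma comm_A_A:
  assumes h: "\<And>n. n \<ge> 1 \<Longrightarrow> comm (A n) b"
  shows "comm (A (Suc k)) (A (Suc l))"
proof -
  let ?W = "\<lambda>k x. V (A (Suc k) (U x))"
  have ASS: "A (Suc (Suc k)) = (\<lambda>x. a (?W k x))" for k using A_Suc[OF h] by simp
  have aW: "a (?W k x) = ?W k (a x)" for k x using comm_a_conj[OF h[of "Suc k"]] by (simp add: comm_def)
  have A1: "A (Suc 0) = a" using A_1 by simp
  have base: "comm a (A (Suc l))" for l
    by (cases l) (auto simp: A1 ASS comm_def aW)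
  show ?thesis
  proof (induction k arbitrary: l)
    case 0
    show ?case using base by (simp add: A1)
  next
    case (Suc k)
    show ?case
    proof (cases l)
      case 0
      then show ?thesis using comm_sym[OF base] by (simp add: A1)
    next
      case (Suc j)
      have "?W p (?W q x) = V (A (Suc p) (A (Suc q) (U x)))" for p q x
      proof -
        have "?W p (?W q x) = V (A (Suc p) (A (Suc q) (U (V (U x)))))"
          using comm_UV[OF apA h[of "Suc q"]] by simp
        then show ?thesis by (simp add: UVU)
      qed
      then have "?W k (?W j x) = ?W j (?W k x)" for x using Suc.IH[of j] by (simp add: comm_def)
      then have "a (?W k (a (?W j x))) = a (?W j (a (?W k x)))" for x by (simp flip: aW)
      then show ?thesis unfolding \<open>l = Suc j\<close> ASS comm_def by blast
    qed
  qed
qed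

text \<open>The dual of \<open>A_Suc\<close> writes \<open>B (l + 2)\<close> as \<open>b\<close>
  times the conjugate of \<open>B (l + 1)\<close> by \<open>U\<close>, and
  \<open>comm_A_Suc_iff\<close> trades that conjugation for a higher index of
  \<open>A\<close>.\<close>

lemma comm_A_B:
  assumes h: "\<And>n. n \<ge> 1 \<Longrightarrow> comm (A n) b"
  shows "k \<ge> 1 \<Longrightarrow> comm (A k) (B (Suc l))"
proof (induction l arbitrary: k)
  case 0
  then show ?case using h B_1 by simp
next
  case (Suc l)
  have Ba: "comm (B (Suc l)) a" using comm_sym[OF Suc.IH[of 1]] by (simp add: A_1 del: One_nat_def)
  have "B (Suc (Suc l)) = (\<lambda>x. b (U (B (Suc l) (V x))))"
    using polar_data.A_Suc[OF dual, of "Suc l"] Ba by (simp add: dual_A dual_b)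
  moreover have "comm (\<lambda>x. U (B (Suc l) (V x))) (A k)"
    using comm_A_Suc_iff[OF apB Ba h[OF Suc.prems]] comm_sym[OF Suc.IH[of "Suc k"]] by simp
  ultimately show ?case using h[OF Suc.prems] by (simp add: comm_def)
qed

lemma comm_B_a_of_comm_A_b:
  assumes "\<And>n. n \<ge> 1 \<Longrightarrow> comm (A n) b" "n \<ge> 1" shows "comm (B n) a"
  using comm_sym[OF comm_A_B[OF assms(1), of 1 "n - 1"]] assms(2) A_1 by auto

text \<open>The two extreme restricted sequences: \<open>t n = 1\<close> pairs each
  \<open>A n\<close> with \<open>am 1 = b\<close>, and \<open>t n = n\<close> pairs each
  \<open>am n\<close> with \<open>A 1 = a\<close>.\<close>

lemma comm_A_b_iff_comm_am_a:
  "(\<forall>n\<ge>1. comm (A n) b) \<longleftrightarrow> (\<forall>n\<ge>1. comm (am n) a)" (is "?iii \<longleftrightarrow> ?vii")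
  and comm_A_b_iff_comm_am_A: "(\<forall>n\<ge>1. comm (A n) b) \<longleftrightarrow> (\<forall>m\<ge>1. \<forall>n\<ge>1. comm (am m) (A n))" (is "_ \<longleftrightarrow> ?vi")
proof -
  have "?iii \<Longrightarrow> ?vi"
    using comm_am_A_of_restricted[of "\<lambda>_. 1"] comm_sym[of _ b] am_1 by simp
  moreover have "?vii \<Longrightarrow> ?vi"
    using comm_am_A_of_restricted[of "\<lambda>n. n"] A_1 by simp
  moreover have "?vi \<Longrightarrow> ?vii" using A_1 by force
  moreover have "?vi \<Longrightarrow> ?iii" using am_1 comm_sym by (metis order_refl)
  ultimately show "?iii \<longleftrightarrow> ?vii" "?iii \<longleftrightarrow> ?vi" by blast+
qed

end

section \<open>The equivalences in terms of polar data\<close>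

context polar_data
begin

text \<open>Commutation passes from squares to positive roots one factor at a time. In the other
  direction the relations among the \<open>B n\<close> come from duality.\<close>

lemma centered_iff: "centered ip T \<longleftrightarrow> (\<forall>n\<ge>1. comm (A n) b)"
proof
  have adj: "adj ip (T ^^ n) = T' ^^ n" for n by (rule adjpair_adj[OF pow_adj])
  have apTT: "adjpair (\<lambda>x. (T' ^^ n) ((T ^^ n) x)) (\<lambda>x. (T' ^^ n) ((T ^^ n) x))" for n
    by (rule adjpair_comp[OF adjpair_sym[OF pow_adj] pow_adj])
  {
    assume c: "centered ip T"
    show "\<forall>n\<ge>1. comm (A n) b"
    proof (intro allI impI)
      fix n :: nat
      assume n: "n \<ge> 1"
      have "commutator ((T' ^^ n) \<circ> (T ^^ n)) ((T ^^ 1) \<circ> (T' ^^ 1)) = (\<lambda>_. 0)"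
        using c n unfolding centered_def commuting_family_def adj by blast
      then have "comm (\<lambda>x. (T' ^^ n) ((T ^^ n) x)) (\<lambda>x. (T ^^ 1) ((T' ^^ 1) x))"
        unfolding commutator_eq_zero_iff by (simp add: comm_def)
      from comm_sym[OF op_abs_comm[OF adjpair_sym[OF pow_adj] apTT this]]
      have "comm b (\<lambda>x. (T' ^^ n) ((T ^^ n) x))"
        unfolding B_def[symmetric] B_1 .
      from op_abs_comm[OF pow_adj apb this] show "comm (A n) b"
        unfolding A_def by (rule comm_sym)
    qed
  }
  {
    assume "\<forall>n\<ge>1. comm (A n) b"
    then have h: "\<And>n. n \<ge> 1 \<Longrightarrow> comm (A n) b" by blast
    have hB: "comm (B n) (polar_data.b V U b)" if "n \<ge> 1" for n
      unfolding dual_b by (rule comm_B_a_of_comm_A_b[OF h that])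
    have AA: "comm (A m) (A n)" and AB: "comm (A m) (B n)" and BB: "comm (B m) (B n)"
      if "m \<ge> 1" "n \<ge> 1" for m n
      using comm_A_A[OF h, of "m - 1" "n - 1"] comm_A_B[OF h, of m "n - 1"]
        polar_data.comm_A_A[OF dual, of "m - 1" "n - 1"] hB that by (simp_all add: dual_A)
    have sq: "comm (\<lambda>x. X (X x)) (\<lambda>x. Y (Y x))" if "comm X Y" for X Y :: "'h \<Rightarrow> 'h"
      using that by (simp add: comm_def)
    have TT: "(T ^^ n) \<circ> (T' ^^ n) = (\<lambda>x. B n (B n x))" "(T' ^^ n) \<circ> (T ^^ n) = (\<lambda>x. A n (A n x))" for n
      by (auto simp: A_square B_square)
    show "centered ip T"
      unfolding centered_def commuting_family_def adj TT commutator_eq_zero_iff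
      using sq[OF AA] sq[OF AB] sq[OF BB] comm_sym[OF sq[OF AB]] by blast
  }
qed

lemma comm_A_b_iff_comm_A_B: "(\<forall>n\<ge>1. comm (A n) b) \<longleftrightarrow> (\<forall>m\<ge>1. \<forall>n\<ge>1. comm (A n) (B m))"
proof
  assume "\<forall>n\<ge>1. comm (A n) b"
  then have "comm (A n) (B m)" if "n \<ge> 1" "m \<ge> 1" for m n
    using comm_A_B[of n "m - 1"] that by simp
  then show "\<forall>m\<ge>1. \<forall>n\<ge>1. comm (A n) (B m)" by blast
next
  assume "\<forall>m\<ge>1. \<forall>n\<ge>1. comm (A n) (B m)"
  then have "\<forall>n\<ge>1. comm (A n) (B 1)" by blast
  then show "\<forall>n\<ge>1. comm (A n) b" unfolding B_1 .
qed

lemma comm_A_b_iff_comm_B_a: "(\<forall>n\<ge>1. comm (A n) b) \<longleftrightarrow> (\<forall>n\<ge>1. comm (B n) a)"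
  using comm_B_a_of_comm_A_b polar_data.comm_B_a_of_comm_A_b[OF dual, unfolded dual_A dual_B dual_b] by metis

lemma comm_B_a_iff_comm_cm_b: "(\<forall>n\<ge>1. comm (B n) a) \<longleftrightarrow> (\<forall>n\<ge>1. comm (cm n) b)"
  using polar_data.comm_A_b_iff_comm_am_a[OF dual] unfolding dual_A dual_b dual_am .

lemma comm_B_a_iff_comm_cm_B: "(\<forall>n\<ge>1. comm (B n) a) \<longleftrightarrow> (\<forall>m\<ge>1. \<forall>n\<ge>1. comm (cm m) (B n))"
  using polar_data.comm_A_b_iff_comm_am_A[OF dual] unfolding dual_A dual_b dual_am .

text \<open>Since \<open>V b U = a\<close>, the operator \<open>a\<close> is \<open>cm 1\<close> and
  its conjugates by \<open>V\<close> are the later \<open>cm\<close>; hence the index shift, and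
  hence only the types \<open>am\<close> and \<open>cm\<close> occur.\<close>

lemma comm_A_b_iff_commuting_family:
  "(\<forall>n\<ge>1. comm (A n) b) \<longleftrightarrow>
    commuting_family ({a} \<union> {am n | n. n \<ge> 1} \<union> {cm (Suc n) | n. n \<ge> 1})" (is "?iii \<longleftrightarrow> ?xi")
proof
  assume iii: ?iii
  have vii: "comm (am n) a" if "n \<ge> 1" for n using iii comm_A_b_iff_comm_am_a that by blast
  have ix: "comm (cm n) b" if "n \<ge> 1" for n using iii comm_A_b_iff_comm_B_a comm_B_a_iff_comm_cm_b that by blast
  have cc: "comm (cm m) (cm n)" for m n
    using polar_data.comm_am_am[OF dual] ix unfolding dual_am by blast
  have c1: "cm (Suc 0) = a" by (simp add: cm_def b_def VUa aVU)
  have sub: "X \<in> {a} \<union> {am n | n. n \<ge> 1} \<union> {cm (Suc n) | n. n \<ge> 1} \<Longrightarrow>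
     (\<exists>n\<ge>1. X = am n) \<or> (\<exists>n. X = cm (Suc n))" for X
    using c1[symmetric] by blast
  show ?xi
    unfolding commuting_family_def commutator_eq_zero_iff
  proof (intro ballI)
    fix X Y
    assume "X \<in> {a} \<union> {am n | n. n \<ge> 1} \<union> {cm (Suc n) | n. n \<ge> 1}"
      and "Y \<in> {a} \<union> {am n | n. n \<ge> 1} \<union> {cm (Suc n) | n. n \<ge> 1}"
    from this[THEN sub] show "comm X Y"
      using comm_am_am[OF vii] comm_am_cm[OF vii] comm_sym[OF comm_am_cm[OF vii]] cc by blast
  qed
next
  assume ?xi
  then have "\<forall>n\<ge>1. comm (am n) a"
    unfolding commuting_family_def commutator_eq_zero_iff by blast
  then show ?iii using comm_A_b_iff_comm_am_a by blast
qed

end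

section \<open>From the polar decomposition to polar data\<close>

context positive_cs_module
begin

text \<open>\<open>V U\<close> projects onto the closed range of the adjoint, whose complement is
  killed by \<open>T\<close> and so by \<open>a\<close>. Conversely, a vector killed by
  \<open>a\<close> is orthogonal to that range, by continuity to its closure, and so to its own
  image under \<open>V U\<close>.\<close>

lemma polar_data_of_polar_decomposition:
  assumes T: "T \<in> adjointable ip" and P: "polar_decomposition ip T U"
  shows "polar_data ip U (adj ip U) (op_abs ip T)"
    and "polar_data.T U (op_abs ip T) = T"
    and "polar_data.T' (adj ip U) (op_abs ip T) = adj ip T"
proof -
  define V where "V = adj ip U"
  define a where "a = op_abs ip T"
  define T' where "T' = adj ip T"
  define M where "M = closure (range T')"
  have apT: "adjpair T T'" unfolding T'_def by (rule adjointable_adjpair[OF T])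
  have "U \<in> adjointable ip" using P by (simp add: polar_decomposition_def partial_isometry_def)
  then have UV: "adjpair U V" unfolding V_def by (rule adjointable_adjpair)
  have proj: "V (U (V (U x))) = V (U x)" for x
    using P unfolding polar_decomposition_def partial_isometry_def projection_op_def V_def
    by (metis comp_apply)
  have T_eq: "T x = U (a x)" for x
    using P unfolding polar_decomposition_def a_def by (metis comp_apply)
  have oc: "orth_complemented ip M" and VU: "V (U x) = orth_proj ip M x" for x
    using P unfolding polar_decomposition_def M_def T'_def V_def by (auto simp: fun_eq_iff)
  have VUM: "V (U x) \<in> M \<and> x - V (U x) \<in> orth_compl ip M" for x
  proof -
    have "x \<in> {u + v | u v. u \<in> M \<and> v \<in> orth_compl ip M}"
      using oc by (simp add: orth_complemented_def)
    then obtain u v where uv: "x = u + v" "u \<in> M" "v \<in> orth_compl ip M" by blast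
    have "orth_proj ip M x = u"
      unfolding orth_proj_def
    proof (rule the_equality)
      show "u \<in> M \<and> x - u \<in> orth_compl ip M" using uv by simp
      fix w
      assume w: "w \<in> M \<and> x - w \<in> orth_compl ip M"
      have "u - w = (x - w) - v" using uv(1) by simp
      then have "ip (u - w) m = 0" if "m \<in> M" for m
        using w uv(3) that by (simp add: orth_compl_def ip.diff_left)
      then have "ip (u - w) (u - w) = 0" using uv(2) w by (simp add: ip.diff_right)
      then show "w = u" using norm_ip_self[of "u - w"] by simp
    qed
    then show ?thesis using uv by (simp add: VU)
  qed
  have zero: "z = 0" if "ip z z = 0" for z using norm_ip_self[of z] that by simp
  have range_M: "T' y \<in> M" for y unfolding M_def by (rule subsetD[OF closure_subset rangeI])
  note lin = linear_diff[OF bounded_linear.linear[OF adjpair_bounded_linear]]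
  have apa: "adjpair a a" unfolding a_def by (rule op_abs_adjpair_self[OF apT])
  have aa: "a (a x) = T' (T x)" for x unfolding a_def by (rule op_abs_square[OF apT])
  show data: "polar_data ip U (adj ip U) (op_abs ip T)"
    unfolding V_def[symmetric] a_def[symmetric]
  proof
    show "adjpair U V" by (rule UV)
    show "pos a" unfolding a_def by (rule pos_op_abs[OF apT])
    show "U (V (U x)) = U x" for x
    proof -
      have "U (x - V (U x)) = 0"
      proof (rule zero)
        have "V (U (x - V (U x))) = 0"
          using lin[OF UV] lin[OF adjpair_sym[OF UV]] proj by simp
        then show "ip (U (x - V (U x))) (U (x - V (U x))) = 0"
          by (simp add: adjpairD[OF UV] ip.zero_right)
      qed
      then show ?thesis using lin[OF UV] by simp
    qed
    show "a (V (U x)) = a x" for x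
    proof -
      define z where "z = x - V (U x)"
      have "T z = 0"
        by (rule zero) (use VUM[of x] range_M in \<open>simp add: adjpairD[OF apT] orth_compl_def z_def\<close>)
      then have "a (a z) = 0"
        using linear_0[OF bounded_linear.linear[OF adjpair_bounded_linear[OF adjpair_sym[OF apT]]]]
        by (simp add: aa)
      then have "a z = 0" by (intro zero) (simp add: adjpairD[OF apa] ip.zero_right)
      then show ?thesis using lin[OF apa] by (simp add: z_def)
    qed
    show "U x = 0" if "a x = 0" for x
    proof (rule zero)
      have "T x = 0"
        using that linear_0[OF bounded_linear.linear[OF adjpair_bounded_linear[OF UV]]]
        by (simp add: T_eq)
      then have "range T' \<subseteq> {m. ip x m = 0}"
        using adjpairD[OF apT, of x] by (auto simp: ip.zero_left)
      moreover have "closed {m. ip x m = 0}"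
        by (intro closed_Collect_eq continuous_intros linear_continuous_on ip.bounded_linear_right)
      ultimately have "M \<subseteq> {m. ip x m = 0}" unfolding M_def by (rule closure_minimal)
      then show "ip (U x) (U x) = 0" using VUM[of x] by (auto simp: adjpairD[OF UV])
    qed
  qed
  show Teq: "polar_data.T U (op_abs ip T) = T"
    unfolding polar_data.T_def[OF data] using T_eq by (auto simp: a_def)
  show "polar_data.T' (adj ip U) (op_abs ip T) = adj ip T"
    using adjpair_adj[OF polar_data.TT'[OF data]] by (simp add: Teq)
qed

text \<open>\<open>commutative_along\<close> brings its own \<open>U\<close>. Since the conclusion
  mentions only absolute values, uniqueness of the polar decomposition is not invoked.\<close>

lemma comm_op_abs_of_commutative_along:
  assumes T: "T \<in> adjointable ip" and t: "restricted_seq t" and c: "commutative_along ip T t" and n: "n \<ge> 1"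
  shows "comm (op_abs ip (T ^^ n)) (op_abs ip (adj ip T))"
proof -
  obtain U where U: "polar_decomposition ip T U"
    and cU: "\<And>n. n \<ge> 1 \<Longrightarrow> comm (U ^^ t n \<circ> op_abs ip T \<circ> adj ip (U ^^ t n)) (op_abs ip (T ^^ (n + 1 - t n)))"
    using c unfolding commutative_along_def commutator_eq_zero_iff by blast
  note data = polar_data_of_polar_decomposition[OF T U]
  interpret P: polar_data ip U "adj ip U" "op_abs ip T" by (rule data(1))
  have am: "U ^^ m \<circ> op_abs ip T \<circ> adj ip (U ^^ m) = P.am m" for m
    using adjpair_adj[OF adjpair_funpow[OF P.UV, of m]] by (auto simp: P.am_def)
  have "\<And>n. n \<ge> 1 \<Longrightarrow> t n \<in> {1..n} \<and> comm (P.am (t n)) (P.A (n + 1 - t n))"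
    using cU t by (simp add: am P.A_def data(2) restricted_seq_def)
  from comm_sym[OF P.comm_am_A_of_restricted[OF this, of 1 n]] n have "comm (P.A n) P.b"
    by (simp add: P.am_1 del: One_nat_def)
  then show ?thesis using P.B_1 by (simp add: P.A_def P.B_def data(2,3))
qed

end

theorem theorem4p6:
  fixes act :: "'h::complex_banach \<Rightarrow> 'a::cstar_algebra \<Rightarrow> 'h"
    and ip :: "'h \<Rightarrow> 'h \<Rightarrow> 'a"
    and T U :: "'h \<Rightarrow> 'h"
  assumes "hilbert_cstar_module act ip"
    and "T \<in> adjointable ip"
    and "polar_decomposition ip T U"
  shows
    "(centered ip T \<longleftrightarrow>
       (\<forall>m\<ge>1. \<forall>n\<ge>1. commutator (op_abs ip (T ^^ n)) (op_abs ip (adj ip (T ^^ m))) = (\<lambda>_. 0)))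
     \<and> (centered ip T \<longleftrightarrow>
       (\<forall>n\<ge>1. commutator (op_abs ip (T ^^ n)) (op_abs ip (adj ip T)) = (\<lambda>_. 0)))
     \<and> (centered ip T \<longleftrightarrow>
       (\<forall>t. restricted_seq t \<longrightarrow> commutative_along ip T t))
     \<and> (centered ip T \<longleftrightarrow>
       (\<exists>t. restricted_seq t \<and> commutative_along ip T t))
     \<and> (centered ip T \<longleftrightarrow>
       (\<forall>m\<ge>1. \<forall>n\<ge>1. commutator (U ^^ m \<circ> op_abs ip T \<circ> adj ip (U ^^ m)) (op_abs ip (T ^^ n)) = (\<lambda>_. 0)))
     \<and> (centered ip T \<longleftrightarrow>
       (\<forall>n\<ge>1. commutator (U ^^ n \<circ> op_abs ip T \<circ> adj ip (U ^^ n)) (op_abs ip T) = (\<lambda>_. 0)))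
     \<and> (centered ip T \<longleftrightarrow>
       (\<forall>n\<ge>1. commutator (op_abs ip (adj ip (T ^^ n))) (op_abs ip T) = (\<lambda>_. 0)))
     \<and> (centered ip T \<longleftrightarrow>
       (\<forall>n\<ge>1. commutator (adj ip (U ^^ n) \<circ> op_abs ip (adj ip T) \<circ> U ^^ n) (op_abs ip (adj ip T)) = (\<lambda>_. 0)))
     \<and> (centered ip T \<longleftrightarrow>
       (\<forall>m\<ge>1. \<forall>n\<ge>1. commutator (adj ip (U ^^ m) \<circ> op_abs ip (adj ip T) \<circ> U ^^ m) (op_abs ip (adj ip (T ^^ n))) = (\<lambda>_. 0)))
     \<and> (centered ip T \<longleftrightarrow>
       commuting_family
         ({op_abs ip T}
          \<union> {U ^^ n \<circ> op_abs ip T \<circ> adj ip (U ^^ n) | n. n \<ge> 1}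
          \<union> {adj ip (U ^^ n) \<circ> op_abs ip T \<circ> U ^^ n | n. n \<ge> 1}))"
proof -
  interpret positive_cs_module ip by (rule hilbert_positive_cs_module[OF assms(1)])
  note data = polar_data_of_polar_decomposition[OF assms(2,3)]
  interpret P: polar_data ip U "adj ip U" "op_abs ip T" by (rule data(1))
  have adjT: "adj ip (T ^^ n) = adj ip T ^^ n" and adjU: "adj ip (U ^^ n) = adj ip U ^^ n" for n
    using adjpair_adj[OF P.pow_adj[of n]] adjpair_adj[OF adjpair_funpow[OF P.UV, of n]]
    by (simp_all add: data(2,3))
  have A: "op_abs ip (T ^^ n) = P.A n" and B: "op_abs ip (adj ip (T ^^ n)) = P.B n" for n
    by (simp_all add: P.A_def P.B_def adjT data(2,3))
  have b: "op_abs ip (adj ip T) = P.b" using B[of 1] P.B_1 by simp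
  have am: "U ^^ n \<circ> op_abs ip T \<circ> adj ip (U ^^ n) = P.am n" for n
    by (auto simp: P.am_def adjU)
  have cm: "adj ip (U ^^ n) \<circ> P.b \<circ> U ^^ n = P.cm n" for n
    by (auto simp: P.cm_def adjU)
  have cmS: "adj ip (U ^^ n) \<circ> op_abs ip T \<circ> U ^^ n = P.cm (Suc n)" for n
  proof
    fix x
    have "P.cm (Suc n) x = (adj ip U ^^ n) (adj ip U (P.b (U ((U ^^ n) x))))"
      by (simp add: P.cm_def funpow_swap1)
    then show "(adj ip (U ^^ n) \<circ> op_abs ip T \<circ> U ^^ n) x = P.cm (Suc n) x"
      by (simp add: P.b_def P.VUa P.aVU adjU)
  qed
  have c: "centered ip T \<longleftrightarrow> (\<forall>n\<ge>1. comm (P.A n) P.b)" using P.centered_iff by (simp add: data(2))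
  have iv: "commutative_along ip T t" if cen: "centered ip T" and t: "restricted_seq t" for t
    unfolding commutative_along_def commutator_eq_zero_iff
  proof (intro exI[of _ U] conjI allI impI assms(3))
    fix n :: nat
    assume "n \<ge> 1"
    then have "t n \<ge> 1" "n + 1 - t n \<ge> 1" using t by (auto simp: restricted_seq_def)
    then show "comm (U ^^ t n \<circ> op_abs ip T \<circ> adj ip (U ^^ t n)) (op_abs ip (T ^^ (n + 1 - t n)))"
      unfolding am A using cen c P.comm_A_b_iff_comm_am_A by blast
  qed
  have v: "centered ip T" if "restricted_seq t" "commutative_along ip T t" for t
    unfolding c using comm_op_abs_of_commutative_along[OF assms(2) that] unfolding A b by blast
  \<comment> \<open>Some restricted sequence must exist for the universal statement to imply the
    existential one.\<close>
  have one: "restricted_seq (\<lambda>_. 1)" by (simp add: restricted_seq_def)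
  show ?thesis
  proof (intro conjI)
    show "centered ip T \<longleftrightarrow> (\<forall>t. restricted_seq t \<longrightarrow> commutative_along ip T t)"
      using iv v one by blast
    show "centered ip T \<longleftrightarrow> (\<exists>t. restricted_seq t \<and> commutative_along ip T t)"
      using iv v one by blast
  qed (unfold commutator_eq_zero_iff A B b cm cmS am c,
      (rule P.comm_A_b_iff_comm_A_B refl P.comm_A_b_iff_comm_am_A P.comm_A_b_iff_comm_am_a P.comm_A_b_iff_comm_B_a
        P.comm_A_b_iff_comm_B_a[THEN trans, OF P.comm_B_a_iff_comm_cm_b] P.comm_A_b_iff_comm_B_a[THEN trans, OF P.comm_B_a_iff_comm_cm_B]
        P.comm_A_b_iff_commuting_family)+)
qed

end
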